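(* Let $m$ and $n$ be non-negative integers. Then $$\pi(m,n)=\sum_{0\le k\le \min(m,n)}c\left(\min(m,n)-k\right)\alpha(|m-n|,k),$$ where $$\alpha(s,k)=\sum_{\ell\ge 0}(-1)^{\ell}\,p\left(k-\frac{\ell(\ell+1)}{2}-\ell s\right),$$ with $p(r):=0$ for all $r<0$. In particular, for each integer $k\ge 0$, $\pi(0,k)=\pi(k,0)=1$. Moreover, let $D(m,n):=\pi(m,n)-\pi(m-1,n)$ with $\pi(-1,n):=0$. Then $$D(m,n)=\sum_{0\le k\le L_{m,n}}c(L_{m,n}-k)\,M(n-L_{m,n},\,n-L_{m,n}+k),$$ where $L_{m,n}:=\min(2n-m,m)$ (the sum being empty, hence $0$, if $L_{m,n}<0$). In particular, if $m>2n$ then $D(m,n)=0$.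
   Context: An integer partition is a non-increasing sequence $\lambda=(\lambda_1,\lambda_2,\dots)$ of non-negative integers; it is a partition of $n$ if $\lambda_1+\lambda_2+\cdots=n$ (so all but finitely many $\lambda_j$ are $0$). $p(n)$ denotes the number of partitions of $n$, with $p(0)=1$. For partitions $\alpha=(\alpha_1,\alpha_2,\dots)$ and $\beta=(\beta_1,\beta_2,\dots)$, the pair $(\alpha,\beta)$ is a pair of partitions with steadily decreasing parts if $\min(\alpha_i,\beta_i)\ge \max(\alpha_{i+1},\beta_{i+1})$ for all integers $i\ge 1$. For integers $m,n\ge 0$, $\pi(m,n)$ is the number of pairs $(\alpha,\beta)$ with steadily decreasing parts such that $\alpha_1+\alpha_2+\cdots=m$ and $\beta_1+\beta_2+\cdots=n$. Write $(a;q)_\infty=\prod_{j\ge 0}(1-aq^j)$ for $|q|<1$. The cubic partition function $c(n)$, $n\ge 0$, is defined by $$\sum_{n\ge 0}c(n)q^n=\frac{1}{(q;q)_\infty(q^2;q^2)_\infty}.$$ The crank counting function $M(m,n)$, for $m\in\mathbb{Z}$ and $n\ge 0$, is defined by the generating function (with the expansion as a power series in $q$ whose coefficients are Laurent polynomials in $\zeta$) $$\sum_{n\ge 0}\sum_{m\in\mathbb{Z}}M(m,n)q^n\zeta^m=\frac{(q;q)_\infty}{(\zeta q;q)_\infty(\zeta^{-1}q;q)_\infty}.$$ *)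

theory Defs
  imports
    "HOL-Analysis.Infinite_Products"
    "HOL-Computational_Algebra.Formal_Power_Series"
    "HOL-Library.Poly_Mapping"
begin

text \<open>Sequences are indexed from 0: the part usually written \<open>\<lambda>\<^sub>j\<close> (with \<open>j \<ge> 1\<close>)
  is \<open>f (j - 1)\<close>.\<close>

definition partition_of :: "(nat \<Rightarrow> nat) \<Rightarrow> nat \<Rightarrow> bool" where
  "partition_of f n \<longleftrightarrow> decseq f \<and> finite {i. f i \<noteq> 0} \<and> (\<Sum>i | f i \<noteq> 0. f i) = n"

definition num_partitions :: "int \<Rightarrow> nat" where
  "num_partitions r = (if r < 0 then 0 else card {f. partition_of f (nat r)})"

definition steadily_decreasing :: "(nat \<Rightarrow> nat) \<Rightarrow> (nat \<Rightarrow> nat) \<Rightarrow> bool" where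
  "steadily_decreasing f g \<longleftrightarrow> (\<forall>i. min (f i) (g i) \<ge> max (f (Suc i)) (g (Suc i)))"

definition num_steady_pairs :: "nat \<Rightarrow> nat \<Rightarrow> nat" where
  "num_steady_pairs m n =
     card {(f, g). partition_of f m \<and> partition_of g n \<and> steadily_decreasing f g}"

lemma finite_partitions: "finite {f. partition_of f n}"
proof -
  define S :: "(nat \<Rightarrow> nat) set"
    where "S = {f. f ` {..<n} \<subseteq> {..n} \<and> (\<forall>i. i \<notin> {..<n} \<longrightarrow> f i = 0)}"
  have "{f. partition_of f n} \<subseteq> S"
  proof
    fix f assume "f \<in> {f. partition_of f n}"
    then have dec: "decseq f" and fin: "finite {i. f i \<noteq> 0}"
      and sum: "(\<Sum>i | f i \<noteq> 0. f i) = n"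
      by (auto simp: partition_of_def)
    have le: "f i \<le> n" for i
    proof (cases "f i = 0")
      case False
      then have "f i \<le> (\<Sum>i | f i \<noteq> 0. f i)"
        using fin by (intro member_le_sum) auto
      then show ?thesis using sum by simp
    qed simp
    moreover have "f i = 0" if "i \<ge> n" for i
    proof (rule ccontr)
      assume "f i \<noteq> 0"
      have sub: "{..i} \<subseteq> {i. f i \<noteq> 0}"
      proof
        fix j assume "j \<in> {..i}"
        then have "f i \<le> f j" using dec by (auto simp: decseq_def)
        then show "j \<in> {i. f i \<noteq> 0}" using \<open>f i \<noteq> 0\<close> by auto
      qed
      have "Suc i = (\<Sum>j\<le>i. 1)" by simp
      also have "\<dots> \<le> (\<Sum>j\<le>i. f j)"
      proof (rule sum_mono)
        fix j assume "j \<in> {..i}"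
        then have "f j \<noteq> 0" using sub by blast
        then show "1 \<le> f j" by simp
      qed
      also have "\<dots> \<le> (\<Sum>i | f i \<noteq> 0. f i)"
        by (rule sum_mono2[OF fin sub]) simp
      finally show False using sum that by simp
    qed
    ultimately show "f \<in> S" by (auto simp: S_def)
  qed
  moreover have "finite S"
    unfolding S_def
    by (rule finite_subset[OF _ finite_set_of_finite_funs[of "{..<n}" "{..n}" 0]]) auto
  ultimately show ?thesis by (rule finite_subset)
qed

lemma finite_steady_pairs:
  "finite {(f, g). partition_of f m \<and> partition_of g n \<and> steadily_decreasing f g}"
proof (rule finite_subset)
  show "{(f, g). partition_of f m \<and> partition_of g n \<and> steadily_decreasing f g}
      \<subseteq> {f. partition_of f m} \<times> {g. partition_of g n}"
    by blast
  show "finite ({f. partition_of f m} \<times> {g. partition_of g n})"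
    by (intro finite_cartesian_product finite_partitions)
qed

text \<open>\<open>(a; q)\<^sub>\<infinity>\<close> is taken as an infinite product of formal power series in the indeterminate
  \<^const>\<open>fps_X\<close>; both \<open>a\<close> and \<open>q\<close> are to be series with zero constant term.\<close>

definition qpoch_inf :: "'a::comm_ring_1 fps \<Rightarrow> 'a fps \<Rightarrow> 'a fps" where
  "qpoch_inf a q = prodinf (\<lambda>j. 1 - a * q ^ j)"

lemma qpoch_inf:
  fixes a q :: "'a::comm_ring_1 fps"
  assumes a: "fps_nth a 0 = 0" and q: "fps_nth q 0 = 0"
  shows "(\<lambda>j. 1 - a * q ^ j) has_prod qpoch_inf a q"
    and "(\<lambda>N. \<Prod>j\<le>N. 1 - a * q ^ j) \<longlonglongrightarrow> qpoch_inf a q"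
    and "fps_nth (qpoch_inf a q) 0 = 1"
proof -
  define P where "P N = (\<Prod>j\<le>N. 1 - a * q ^ j)" for N
  define F where "F = Abs_fps (\<lambda>n. fps_nth (P n) n)"
  have step: "fps_nth (P (Suc N)) n = fps_nth (P N) n" if "n \<le> N" for n N
  proof -
    have z: "fps_nth (q ^ Suc N) i = 0" if "i \<le> n" for i
      using startsby_zero_power_prefix[OF q, of "Suc N"] that \<open>n \<le> N\<close> by auto
    have "P (Suc N) = P N - (P N * a) * q ^ Suc N"
      by (simp add: P_def algebra_simps)
    moreover have "fps_nth ((P N * a) * q ^ Suc N) n = 0"
      unfolding fps_mult_nth by (intro sum.neutral ballI) (simp add: z del: power_Suc)
    ultimately show ?thesis by simp
  qed
  have stable: "fps_nth (P N) n = fps_nth (P n) n" if "n \<le> N" for n N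
    using that by (induction N rule: dec_induct) (auto simp: step)
  have lim: "P \<longlonglongrightarrow> F"
    by (rule tendsto_fpsI) (auto simp: F_def eventually_sequentially intro!: stable)
  have F0: "fps_nth F 0 = 1"
    using a by (simp add: F_def P_def)
  have "F \<noteq> 0" using F0 by auto
  with lim have raw: "raw_has_prod (\<lambda>j. 1 - a * q ^ j) 0 F"
    by (simp add: raw_has_prod_def P_def[abs_def])
  have nz: "1 - a * q ^ j \<noteq> 0" for j
  proof
    assume "1 - a * q ^ j = 0"
    then have "fps_nth (1 - a * q ^ j) 0 = 0" by simp
    then show False using a by simp
  qed
  have "G = F" if "(\<lambda>j. 1 - a * q ^ j) has_prod G" for G
  proof -
    have "raw_has_prod (\<lambda>j. 1 - a * q ^ j) 0 G"
      using that nz unfolding has_prod_def by blast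
    then show ?thesis using raw unfolding raw_has_prod_def by (blast intro: LIMSEQ_unique)
  qed
  moreover have hp: "(\<lambda>j. 1 - a * q ^ j) has_prod F"
    using raw by (simp add: has_prod_def)
  ultimately have eq: "qpoch_inf a q = F"
    unfolding qpoch_inf_def prodinf_def by (rule the_equality[rotated])
  show "(\<lambda>j. 1 - a * q ^ j) has_prod qpoch_inf a q" using hp eq by simp
  show "(\<lambda>N. \<Prod>j\<le>N. 1 - a * q ^ j) \<longlonglongrightarrow> qpoch_inf a q"
    using lim eq by (simp add: P_def[abs_def])
  show "fps_nth (qpoch_inf a q) 0 = 1" using F0 eq by simp
qed

text \<open>Here \<open>fps_right_inverse f 1\<close> is the multiplicative inverse of a series \<open>f\<close> with constant
  term 1 over an arbitrary commutative ring; it replaces \<open>1 / f\<close>, which the library provides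
  only over coefficient rings with an \<^const>\<open>inverse\<close> operation.\<close>

definition cubic_partitions :: "nat \<Rightarrow> int" where
  "cubic_partitions n =
     fps_nth (fps_right_inverse (qpoch_inf fps_X fps_X * qpoch_inf (fps_X\<^sup>2) (fps_X\<^sup>2)) 1) n"

lemma cubic_partitions_gf:
  "Abs_fps cubic_partitions *
     (qpoch_inf fps_X fps_X * qpoch_inf (fps_X\<^sup>2) (fps_X\<^sup>2)) = 1"
proof -
  let ?f = "qpoch_inf fps_X fps_X * qpoch_inf (fps_X\<^sup>2) (fps_X\<^sup>2) :: int fps"
  have "fps_nth ?f 0 * 1 = 1" by (simp add: qpoch_inf(3) power2_eq_square)
  then have "?f * fps_right_inverse ?f 1 = 1" by (rule fps_right_inverse)
  moreover have "Abs_fps cubic_partitions = fps_right_inverse ?f 1"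
    by (simp add: fps_eq_iff cubic_partitions_def)
  ultimately show ?thesis by (metis mult.commute)
qed

text \<open>Integer Laurent polynomials in \<open>\<zeta>\<close>: \<open>Poly_Mapping.lookup f m\<close> is the coefficient of \<open>\<zeta>\<^sup>m\<close>.\<close>

type_synonym int_laurent_poly = "int \<Rightarrow>\<^sub>0 int"

definition zeta_pow :: "int \<Rightarrow> int_laurent_poly" where
  "zeta_pow k = Poly_Mapping.single k 1"

definition crank_gf :: "int_laurent_poly fps" where
  "crank_gf = qpoch_inf fps_X fps_X *
     fps_right_inverse
       (qpoch_inf (fps_const (zeta_pow 1) * fps_X) fps_X *
        qpoch_inf (fps_const (zeta_pow (-1)) * fps_X) fps_X) 1"

definition crank_count :: "int \<Rightarrow> nat \<Rightarrow> int" where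
  "crank_count m n = Poly_Mapping.lookup (fps_nth crank_gf n) m"

lemma crank_gf:
  "crank_gf *
     (qpoch_inf (fps_const (zeta_pow 1) * fps_X) fps_X *
      qpoch_inf (fps_const (zeta_pow (-1)) * fps_X) fps_X) = qpoch_inf fps_X fps_X"
proof -
  define f where "f = qpoch_inf (fps_const (zeta_pow 1) * fps_X) fps_X *
      qpoch_inf (fps_const (zeta_pow (-1)) * fps_X) fps_X"
  have "fps_nth f 0 * 1 = 1" by (simp add: f_def qpoch_inf(3))
  then have "f * fps_right_inverse f 1 = 1" by (rule fps_right_inverse)
  moreover have "crank_gf * f = qpoch_inf fps_X fps_X * fps_right_inverse f 1 * f"
    unfolding crank_gf_def f_def ..
  moreover have "\<dots> = qpoch_inf fps_X fps_X * (f * fps_right_inverse f 1)"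
    by (metis mult.assoc mult.commute)
  ultimately have "crank_gf * f = qpoch_inf fps_X fps_X" by (metis mult.right_neutral)
  then show ?thesis unfolding f_def .
qed

definition alpha_coeff :: "nat \<Rightarrow> nat \<Rightarrow> int" where
  "alpha_coeff s k =
     suminf (\<lambda>l. (-1) ^ l * int (num_partitions (int k - int (l * (l + 1) div 2) - int (l * s))))"

lemma alpha_coeff_finite:
  "alpha_coeff s k =
     (\<Sum>l\<le>k. (-1) ^ l * int (num_partitions (int k - int (l * (l + 1) div 2) - int (l * s))))"
  unfolding alpha_coeff_def
proof (rule suminf_finite)
  fix l assume "l \<notin> {..k}"
  then have "k < l" by simp
  moreover have "l \<le> l * (l + 1) div 2"
    by (cases l) (simp_all add: less_eq_div_iff_mult_less_eq)
  ultimately have "int k - int (l * (l + 1) div 2) - int (l * s) < 0" by linarith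
  then show "(-1) ^ l * int (num_partitions (int k - int (l * (l + 1) div 2) - int (l * s))) = 0"
    by (simp add: num_partitions_def)
qed simp

definition D_diff :: "nat \<Rightarrow> nat \<Rightarrow> int" where
  "D_diff m n = int (num_steady_pairs m n) - (if m = 0 then 0 else int (num_steady_pairs (m - 1) n))"

definition L_index :: "nat \<Rightarrow> nat \<Rightarrow> int" where
  "L_index m n = min (2 * int n - int m) (int m)"

end

theory Submission
  imports Defs
begin

text \<open>Put \<open>x = \<zeta>\<close>, \<open>y = q / \<zeta>\<close> and let \<open>D\<^sub>k\<close> be the generating function of the pairs with at most \<open>k\<close>
  rows in which the first part of the first partition is as small as the other parts allow.
  Subtracting one from all parts in the first \<open>k\<close> rows, as long as the last row is nonzero and
  skipping a zero part in it, removes weight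
  \<open>q\<^sup>k\<close>, \<open>\<zeta>q\<^bsup>k-1\<^esup>\<close> or \<open>\<zeta>\<^sup>-\<^sup>1q\<^sup>k\<close>, and this yields
  \<open>D\<^sub>k (1 - q\<^sup>k) (1 - \<zeta>q\<^bsup>k-1\<^esup>) (1 - \<zeta>\<^sup>-\<^sup>1q\<^sup>k) = D\<^bsub>k-1\<^esub> (1 - q\<^bsup>2k-1\<^esup>)\<close>.
  In the limit the series of \<open>D(m,n)\<close> is the crank series times the cubic partition series, which
  is the second formula. Summing it over the first argument leads to tails of the coefficients of
  the crank series; with \<open>h\<^sub>b = 1 / (q;q)\<^sub>b\<close>, the tail from \<open>\<zeta>\<^sup>s\<close> on is \<open>(q;q)\<^sub>\<infinity>\<close> times
  \<open>N\<^sub>s = \<Sum>\<^sub>b q\<^bsup>b+s\<^esup> h\<^sub>b h\<^bsub>b+s\<^esub>\<close>. The partial sums of \<open>N\<^sub>s + q\<^sup>s N\<^bsub>s+1\<^esub>\<close> telescope, so this sum equals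
  \<open>q\<^sup>s / (q;q)\<^sub>\<infinity>\<^sup>2\<close>. The series \<open>q\<^sup>s \<Sum>\<^sub>k \<alpha>(s,k) q\<^sup>k / (q;q)\<^sub>\<infinity>\<close> satisfies the same recursion, which has
  only one solution, and this gives the first formula.\<close>

unbundle no vec_syntax and fps_syntax

subsection \<open>Limits of formal power series\<close>

text \<open>Stands in for division: \<open>c\<close> is the reciprocal of \<open>x\<close>, so the
  rule also serves over Laurent polynomial coefficients.\<close>

lemma eq_mult_of_mult_eq_1:
  fixes a b c x :: "'a::comm_monoid_mult"
  assumes "a * x = b" "c * x = 1"
  shows "a = b * c"
proof -
  have "a = a * (c * x)" by (simp add: assms(2))
  also have "\<dots> = a * x * c" by (simp only: mult_ac)
  finally show ?thesis by (simp only: assms(1))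
qed

lemma tendsto_fps_diff:
  fixes f g :: "nat \<Rightarrow> 'a::comm_ring_1 fps"
  assumes "f \<longlonglongrightarrow> a" and "g \<longlonglongrightarrow> b"
  shows "(\<lambda>n. f n - g n) \<longlonglongrightarrow> a - b"
proof (rule tendsto_fpsI)
  fix n
  have "\<forall>\<^sub>F N in sequentially. f N $ n = a $ n" "\<forall>\<^sub>F N in sequentially. g N $ n = b $ n"
    using assms by (auto simp: tendsto_fps_iff)
  then show "\<forall>\<^sub>F N in sequentially. (f N - g N) $ n = (a - b) $ n"
    by eventually_elim simp
qed

lemma tendsto_fps_add:
  fixes f g :: "nat \<Rightarrow> 'a::comm_ring_1 fps"
  assumes "f \<longlonglongrightarrow> a" and "g \<longlonglongrightarrow> b"
  shows "(\<lambda>n. f n + g n) \<longlonglongrightarrow> a + b"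
proof (rule tendsto_fpsI)
  fix n
  have "\<forall>\<^sub>F N in sequentially. f N $ n = a $ n" "\<forall>\<^sub>F N in sequentially. g N $ n = b $ n"
    using assms by (auto simp: tendsto_fps_iff)
  then show "\<forall>\<^sub>F N in sequentially. (f N + g N) $ n = (a + b) $ n"
    by eventually_elim simp
qed

text \<open>A coefficient of a product involves finitely many coefficients of the factors, and these
  are eventually constant simultaneously.\<close>

lemma tendsto_fps_mult:
  fixes f g :: "nat \<Rightarrow> 'a::comm_ring_1 fps"
  assumes "f \<longlonglongrightarrow> a" and "g \<longlonglongrightarrow> b"
  shows "(\<lambda>n. f n * g n) \<longlonglongrightarrow> a * b"
proof (rule tendsto_fpsI)
  fix n
  have "\<forall>\<^sub>F N in sequentially. \<forall>i\<in>{..n}. f N $ i = a $ i \<and> g N $ i = b $ i"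
    using assms by (intro eventually_ball_finite ballI eventually_conj) (auto simp: tendsto_fps_iff)
  then show "\<forall>\<^sub>F N in sequentially. (f N * g N) $ n = (a * b) $ n"
    by eventually_elim (auto simp: fps_mult_nth intro!: sum.cong)
qed

lemma tendsto_fps_X_power_mult:
  fixes f :: "nat \<Rightarrow> 'a::comm_ring_1 fps"
  assumes "\<And>N. N \<le> e N"
  shows "(\<lambda>N. fps_X ^ e N * f N) \<longlonglongrightarrow> 0"
proof (rule tendsto_fpsI)
  fix n
  show "\<forall>\<^sub>F N in sequentially. (fps_X ^ e N * f N) $ n = (0::'a fps) $ n"
    using eventually_gt_at_top[of n]
  proof eventually_elim
    case (elim N)
    then show ?case using assms[of N] by (simp add: fps_X_power_mult_nth)
  qed
qed

section \<open>Finite q-Pochhammer products and their reciprocals\<close>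

definition qpoch :: "'a::comm_ring_1 fps \<Rightarrow> 'a fps \<Rightarrow> nat \<Rightarrow> 'a fps" where
  "qpoch a q n = (\<Prod>j<n. 1 - a * q ^ j)"

lemma qpoch_0 [simp]: "qpoch a q 0 = 1"
  by (simp add: qpoch_def)

lemma qpoch_Suc: "qpoch a q (Suc n) = qpoch a q n * (1 - a * q ^ n)"
  by (simp add: qpoch_def)

lemma tendsto_qpoch:
  assumes "a $ 0 = 0" and "q $ 0 = 0"
  shows "qpoch a q \<longlonglongrightarrow> qpoch_inf a q"
  using qpoch_inf(2)[OF assms]
  \<comment> \<open>The factors of \<open>qpoch\<close> run over j < n, the partial products of
    \<open>qpoch_inf\<close> include j = N; hence the shift by one.\<close>
  by (subst filterlim_sequentially_Suc[symmetric]) (simp add: qpoch_def lessThan_Suc_atMost)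

text \<open>The factors \<open>1 - q^j\<close> are sorted by the parity of j. The finite identity
  with 2N factors passes to the limit along a subsequence.\<close>

lemma qpoch_inf_odd_even:
  "qpoch_inf fps_X fps_X = qpoch_inf fps_X (fps_X\<^sup>2) * qpoch_inf (fps_X\<^sup>2) (fps_X\<^sup>2 :: 'a::comm_ring_1 fps)"
proof (rule LIMSEQ_unique)
  have *: "qpoch fps_X fps_X (2 * N) = qpoch fps_X (fps_X\<^sup>2) N * qpoch (fps_X\<^sup>2) (fps_X\<^sup>2) (N::nat)"
    for N by (induction N)
      (simp_all add: qpoch_Suc power_mult[symmetric] power_add[symmetric] algebra_simps power2_eq_square mult_2 mult_2_right)
  have "(\<lambda>N. qpoch fps_X fps_X (2 * N)) \<longlonglongrightarrow> qpoch_inf fps_X (fps_X :: 'a fps)"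
    using tendsto_qpoch[of fps_X fps_X] by (rule LIMSEQ_subseq_LIMSEQ[unfolded comp_def]) (auto simp: strict_mono_def)
  then show "(\<lambda>N. qpoch fps_X (fps_X\<^sup>2) N * qpoch (fps_X\<^sup>2) (fps_X\<^sup>2) N) \<longlonglongrightarrow> qpoch_inf fps_X (fps_X :: 'a fps)"
    by (simp add: *)
  show "(\<lambda>N. qpoch fps_X (fps_X\<^sup>2) N * qpoch (fps_X\<^sup>2) (fps_X\<^sup>2) N) \<longlonglongrightarrow>
    qpoch_inf fps_X (fps_X\<^sup>2) * qpoch_inf (fps_X\<^sup>2) (fps_X\<^sup>2 :: 'a fps)"
    by (intro tendsto_fps_mult tendsto_qpoch) simp_all
qed

text \<open>The value 0 at negative arguments makes \<open>inv_qfac_diff\<close> valid at 0 as well,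
  and lets a sum over \<open>b\<close> with second index \<open>b + s\<close> start at 0 whatever
  the sign of \<open>s\<close>.\<close>

definition inv_qfac :: "int \<Rightarrow> int fps" where
  "inv_qfac a = (if a < 0 then 0 else fps_right_inverse (qpoch fps_X fps_X (nat a)) 1)"

lemma qpoch_nth_0: "a $ 0 = 0 \<Longrightarrow> qpoch a q n $ 0 = 1"
  by (induction n) (simp_all add: qpoch_Suc)

lemma inv_qfac_neg [simp]: "a < 0 \<Longrightarrow> inv_qfac a = 0"
  by (simp add: inv_qfac_def)

lemma qpoch_mult_inv_qfac: "qpoch fps_X fps_X n * inv_qfac (int n) = 1"
  using fps_right_inverse[of "qpoch fps_X fps_X n" "1::int"]
  by (simp add: inv_qfac_def qpoch_nth_0)

lemma inv_qfac_0 [simp]: "inv_qfac 0 = 1"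
  using qpoch_mult_inv_qfac[of 0] by simp

lemma inv_qfac_diff: "inv_qfac a - inv_qfac (a - 1) = fps_X ^ nat a * inv_qfac a"
proof (cases "a \<le> 0")
  case True
  then show ?thesis by (cases "a = 0") simp_all
next
  case False
  define n where "n = nat (a - 1)"
  have a: "a = int (Suc n)" "a - 1 = int n" "nat a = Suc n" using False by (simp_all add: n_def)
  have "qpoch fps_X fps_X n * ((1 - fps_X * fps_X ^ n) * inv_qfac a)
      = qpoch fps_X fps_X n * inv_qfac (a - 1)"
    using qpoch_mult_inv_qfac[of n] qpoch_mult_inv_qfac[of "Suc n"]
    unfolding a(2) qpoch_Suc by (simp add: a(1) mult.assoc)
  moreover have "qpoch fps_X fps_X n \<noteq> (0 :: int fps)"
    using qpoch_mult_inv_qfac[of n] by auto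
  ultimately have "(1 - fps_X * fps_X ^ n) * inv_qfac a = inv_qfac (a - 1)"
    by simp
  then show ?thesis by (simp add: a(3) algebra_simps)
qed

lemma inv_qfac_pred:
  "inv_qfac (int n) = inv_qfac (int (Suc n)) - fps_X ^ Suc n * inv_qfac (int (Suc n))"
  unfolding diff_eq_eq using inv_qfac_diff[of "int (Suc n)"]
  by (simp only: nat_int) (simp add: algebra_simps)

subsection \<open>Coefficients of the crank series\<close>

text \<open>The coefficient of \<open>\<zeta>\<^sup>s\<close> in \<open>1 / ((\<zeta> q\<^sup>i; q)\<^sub>\<infinity> (\<zeta>\<^sup>-\<^sup>1 q\<^sup>j; q)\<^sub>\<infinity>)\<close>, by Euler's expansion
  of each factor.\<close>

definition recip_coeff_sum :: "nat \<Rightarrow> nat \<Rightarrow> int \<Rightarrow> nat \<Rightarrow> int fps" where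
  "recip_coeff_sum i j s N = (\<Sum>b\<le>N. fps_X ^ (i * nat (int b + s) + j * b)
     * (inv_qfac (int b) * inv_qfac (int b + s)))"

definition recip_coeff :: "nat \<Rightarrow> nat \<Rightarrow> int \<Rightarrow> int fps" where
  "recip_coeff i j s = Abs_fps (\<lambda>n. recip_coeff_sum i j s n $ n)"

text \<open>Multiplication by \<open>1 - \<zeta> q^i\<close>, read on the coefficient of
  \<open>\<zeta>^s\<close>, deletes the first factor of the first product. It works term by term,
  since \<open>b\<close> stays fixed and \<open>inv_qfac_diff\<close> applies to the index
  \<open>b + s\<close>.\<close>

lemma recip_coeff_sum_left:
  "recip_coeff_sum i j s N - fps_X ^ i * recip_coeff_sum i j (s - 1) N = recip_coeff_sum (Suc i) j s N"
proof -
  have "fps_X ^ (i * nat (int b + s) + j * b) * (inv_qfac (int b) * inv_qfac (int b + s))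
    - fps_X ^ i * (fps_X ^ (i * nat (int b + (s - 1)) + j * b)
        * (inv_qfac (int b) * inv_qfac (int b + (s - 1))))
    = fps_X ^ (Suc i * nat (int b + s) + j * b) * (inv_qfac (int b) * inv_qfac (int b + s))" for b
  proof -
    let ?a = "int b + s"
    \<comment> \<open>The exponents agree for \<open>?a\<close> positive; otherwise both sides
      vanish with \<open>inv_qfac (?a - 1)\<close>.\<close>
    have e: "fps_X ^ i * fps_X ^ (i * nat (?a - 1) + j * b) * inv_qfac (?a - 1)
      = fps_X ^ (i * nat ?a + j * b) * inv_qfac (?a - 1)"
    proof (cases "?a \<le> 0")
      case False
      then have "nat ?a = Suc (nat (?a - 1))" by simp
      then show ?thesis by (simp add: power_add)
    qed simp
    have "fps_X ^ (Suc i * nat ?a + j * b) * (inv_qfac (int b) * inv_qfac ?a) =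
      fps_X ^ (i * nat ?a + j * b) * inv_qfac (int b) * (fps_X ^ nat ?a * inv_qfac ?a)"
      by (simp add: power_add mult_ac)
    also have "\<dots> = fps_X ^ (i * nat ?a + j * b) * (inv_qfac (int b) * inv_qfac ?a)
       - inv_qfac (int b) * (fps_X ^ (i * nat ?a + j * b) * inv_qfac (?a - 1))"
      unfolding inv_qfac_diff[symmetric] by (simp add: algebra_simps)
    also have "\<dots> = fps_X ^ (i * nat ?a + j * b) * (inv_qfac (int b) * inv_qfac ?a)
       - fps_X ^ i * (fps_X ^ (i * nat (?a - 1) + j * b) * (inv_qfac (int b) * inv_qfac (?a - 1)))"
      unfolding e[symmetric] by (simp only: mult_ac)
    finally show ?thesis by (simp add: add_diff_eq)
  qed
  then show ?thesis
    unfolding recip_coeff_sum_def sum_distrib_left sum_subtractf[symmetric] by (intro sum.cong) simp_all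
qed

text \<open>Now the factor \<open>1 - \<zeta>^(-1) q^j\<close> is treated. Terms match only after
  shifting \<open>b\<close> by one, so the truncated sum leaves a boundary term at its upper
  end.\<close>

lemma recip_coeff_sum_right:
  "recip_coeff_sum i j s N - fps_X ^ j * recip_coeff_sum i j (s + 1) N = recip_coeff_sum i (Suc j) s N
     - fps_X ^ (i * nat (int N + 1 + s) + j * Suc N) * (inv_qfac (int N) * inv_qfac (int N + 1 + s))"
proof (induction N)
  case 0
  show ?case by (simp add: recip_coeff_sum_def power_add mult_ac add_ac)
next
  case (Suc N)
  let ?X = "fps_X :: int fps" and ?h = inv_qfac
  have S: "recip_coeff_sum i' j' s' (Suc N) = recip_coeff_sum i' j' s' N
    + ?X ^ (i' * nat (int (Suc N) + s') + j' * Suc N) * (?h (int (Suc N)) * ?h (int (Suc N) + s'))"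
    for i' j' s' by (simp add: recip_coeff_sum_def)
  have d: "?h (int N) = ?h (int (Suc N)) - ?X ^ Suc N * ?h (int (Suc N))"
    by (rule inv_qfac_pred)
  let ?A = "?X ^ (i * nat (int N + 1 + s) + j * Suc N) * ?h (int N + 1 + s)"
  let ?B = "?X ^ (i * nat (int (Suc N) + 1 + s) + j * Suc (Suc N)) * (?h (int (Suc N)) * ?h (int (Suc N) + 1 + s))"
  have "recip_coeff_sum i j s (Suc N) - ?X ^ j * recip_coeff_sum i j (s + 1) (Suc N) =
    (recip_coeff_sum i j s N - ?X ^ j * recip_coeff_sum i j (s + 1) N) + ?A * ?h (int (Suc N)) - ?B"
    unfolding S by (simp add: algebra_simps power_add)
  also have "\<dots> = recip_coeff_sum i (Suc j) s N - ?A * ?h (int N) + ?A * ?h (int (Suc N)) - ?B"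
    unfolding Suc.IH by (simp add: mult_ac)
  also have "\<dots> = recip_coeff_sum i (Suc j) s N + ?A * ?X ^ Suc N * ?h (int (Suc N)) - ?B"
    unfolding d by (simp add: algebra_simps)
  also have "\<dots> = recip_coeff_sum i (Suc j) s (Suc N) - ?B"
    unfolding S by (simp add: algebra_simps power_add)
  finally show ?case .
qed

text \<open>The summand at \<open>b\<close> has order at least \<open>b\<close>, so the coefficient
  of index n is settled in the n-th partial sum, where \<open>recip_coeff\<close> reads it. The
  second alternative admits \<open>i = 1\<close>, \<open>j = 0\<close>, the series
  \<open>N\<^sub>s\<close>.\<close>

lemma tendsto_recip_coeff_sum:
  assumes "j \<ge> 1 \<or> (i \<ge> 1 \<and> s \<ge> 0)"
  shows "recip_coeff_sum i j s \<longlonglongrightarrow> recip_coeff i j s"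
proof (rule tendsto_fpsI)
  fix n
  have deg: "b \<le> i * nat (int b + s) + j * b" for b
  proof (cases "j \<ge> 1")
    case True
    then have "b \<le> j * b" by simp
    then show ?thesis by linarith
  next
    case False
    then have "b \<le> nat (int b + s)" "1 \<le> i" using assms by auto
    then have "1 * b \<le> i * nat (int b + s)" by (intro mult_mono) auto
    then show ?thesis by simp
  qed
  have "recip_coeff_sum i j s N $ n = recip_coeff_sum i j s n $ n" if "n \<le> N" for N
    using that
  proof (induction N rule: dec_induct)
    case (step N)
    then show ?case using deg[of "Suc N"] by (simp add: recip_coeff_sum_def fps_X_power_mult_nth del: mult_Suc_right)
  qed simp
  then show "\<forall>\<^sub>F N in sequentially. recip_coeff_sum i j s N $ n = recip_coeff i j s $ n"
    unfolding recip_coeff_def fps_nth_Abs_fps eventually_sequentially by blast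
qed

lemma recip_coeff_left:
  assumes "j \<ge> 1"
  shows "recip_coeff i j s - fps_X ^ i * recip_coeff i j (s - 1) = recip_coeff (Suc i) j s"
proof (rule LIMSEQ_unique)
  show "(\<lambda>N. recip_coeff_sum i j s N - fps_X ^ i * recip_coeff_sum i j (s - 1) N)
      \<longlonglongrightarrow> recip_coeff i j s - fps_X ^ i * recip_coeff i j (s - 1)"
    using assms by (intro tendsto_fps_diff tendsto_fps_mult tendsto_recip_coeff_sum tendsto_const) auto
  show "(\<lambda>N. recip_coeff_sum i j s N - fps_X ^ i * recip_coeff_sum i j (s - 1) N) \<longlonglongrightarrow> recip_coeff (Suc i) j s"
    using assms by (simp add: recip_coeff_sum_left tendsto_recip_coeff_sum)
qed

text \<open>For \<open>j = 0\<close> this writes \<open>recip_coeff i 1 s\<close> as a difference of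
  neighbours in \<open>s\<close>, which later makes sums of crank coefficients telescope.\<close>

lemma recip_coeff_right:
  assumes "j \<ge> 1 \<or> (i \<ge> 1 \<and> s \<ge> 0)"
  shows "recip_coeff i j s - fps_X ^ j * recip_coeff i j (s + 1) = recip_coeff i (Suc j) s"
proof (rule LIMSEQ_unique)
  show "(\<lambda>N. recip_coeff_sum i j s N - fps_X ^ j * recip_coeff_sum i j (s + 1) N)
      \<longlonglongrightarrow> recip_coeff i j s - fps_X ^ j * recip_coeff i j (s + 1)"
    using assms by (intro tendsto_fps_diff tendsto_fps_mult tendsto_recip_coeff_sum tendsto_const) auto
  \<comment> \<open>The boundary term has order at least \<open>N\<close> and therefore disappears
    in the limit.\<close>
  have deg: "N \<le> i * nat (int N + 1 + s) + j * Suc N" for N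
  proof (cases "j \<ge> 1")
    case True
    then have "1 * Suc N \<le> j * Suc N" by (intro mult_right_mono) auto
    then show ?thesis by simp
  next
    case False
    then have "N \<le> nat (int N + 1 + s)" "1 \<le> i" using assms by auto
    then have "1 * N \<le> i * nat (int N + 1 + s)" by (intro mult_mono) auto
    then show ?thesis by simp
  qed
  have "(\<lambda>N. recip_coeff_sum i (Suc j) s N - fps_X ^ (i * nat (int N + 1 + s) + j * Suc N)
      * (inv_qfac (int N) * inv_qfac (int N + 1 + s))) \<longlonglongrightarrow> recip_coeff i (Suc j) s - 0"
    by (intro tendsto_fps_diff tendsto_recip_coeff_sum tendsto_fps_X_power_mult deg) simp
  then show "(\<lambda>N. recip_coeff_sum i j s N - fps_X ^ j * recip_coeff_sum i j (s + 1) N) \<longlonglongrightarrow> recip_coeff i (Suc j) s"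
    by (simp add: recip_coeff_sum_right)
qed

text \<open>The sum of \<open>b + s\<close> and \<open>b\<close> is at least the absolute value of
  \<open>s\<close> whenever \<open>b + s\<close> is nonnegative. This lets the family in
  \<open>s\<close> be assembled into Laurent polynomials.\<close>

lemma recip_coeff_eq_0:
  assumes "i \<ge> 1" "j \<ge> 1" "int n < \<bar>s\<bar>"
  shows "recip_coeff i j s $ n = 0"
proof -
  have "(fps_X ^ (i * nat (int b + s) + j * b) * (inv_qfac (int b) * inv_qfac (int b + s))) $ n = 0" for b
  proof (cases "int b + s < 0")
    case False
    have "1 * nat (int b + s) \<le> i * nat (int b + s)" "1 * b \<le> j * b"
      using assms by (intro mult_right_mono; simp)+
    then have "n < i * nat (int b + s) + j * b" using False assms by linarith
    then show ?thesis by (simp add: fps_X_power_mult_nth)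
  qed simp
  then show ?thesis by (simp add: recip_coeff_def recip_coeff_sum_def fps_sum_nth)
qed

text \<open>Every term other than the one with \<open>b = 0\<close> and \<open>s = 0\<close>
  vanishes or has order at least \<open>N\<close>.\<close>

lemma recip_coeff_large:
  assumes "n < N"
  shows "recip_coeff N N s $ n = (if s = 0 \<and> n = 0 then 1 else 0)"
proof -
  have z: "(fps_X ^ (N * nat (int b + s) + N * b) * (inv_qfac (int b) * inv_qfac (int b + s))) $ n = 0"
    if "b \<noteq> 0 \<or> s \<noteq> 0" for b
  proof (cases "int b + s < 0")
    case False
    then have "nat (int b + s) + b \<ge> 1" using that by auto
    then have "N * 1 \<le> N * (nat (int b + s) + b)" by (rule mult_left_mono) simp
    then have "n < N * nat (int b + s) + N * b" using assms by (simp add: distrib_left)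
    then show ?thesis by (simp add: fps_X_power_mult_nth)
  qed simp
  have "recip_coeff N N s $ n = (\<Sum>b\<le>n. if b = 0 then (fps_X ^ (N * nat s) * inv_qfac s) $ n else 0)"
    unfolding recip_coeff_def recip_coeff_sum_def fps_sum_nth fps_nth_Abs_fps using z
    by (intro sum.cong) auto
  also have "\<dots> = (fps_X ^ (N * nat s) * inv_qfac s) $ n"
    by simp
  finally show ?thesis using z[of 0] assms by (cases "s = 0") auto
qed

text \<open>The two indices \<open>b\<close> and \<open>b + s\<close> are exchanged.\<close>

lemma recip_coeff_symmetric: "recip_coeff 1 1 (- s) = recip_coeff 1 1 s"
proof -
  have *: "recip_coeff 1 1 (- int s) $ n = recip_coeff 1 1 (int s) $ n" for s n
  proof (cases "s \<le> n")
    case False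
    then show ?thesis by (simp add: recip_coeff_eq_0)
  next
    case True
    define t where "t b = fps_X ^ (b + (b + s)) * (inv_qfac (int b) * inv_qfac (int (b + s)))" for b
    \<comment> \<open>For \<open>b < s\<close> the second reciprocal has a negative argument and is
      zero by convention.\<close>
    have "recip_coeff 1 1 (- int s) $ n = (\<Sum>b\<le>n. (if b < s then 0 else t (b - s) $ n))"
      unfolding recip_coeff_def recip_coeff_sum_def fps_sum_nth fps_nth_Abs_fps
      by (intro sum.cong) (auto simp: t_def mult_ac nat_diff_distrib of_nat_diff int_ops)
    also have "\<dots> = (\<Sum>b\<in>{s..n}. t (b - s) $ n)"
      by (rule sum.mono_neutral_cong_right) auto
    also have "\<dots> = (\<Sum>b\<le>n - s. t b $ n)"
      using True by (intro sum.reindex_bij_witness[of _ "\<lambda>b. b + s" "\<lambda>b. b - s"]) auto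
    \<comment> \<open>The added terms have order \<open>2b + s\<close>, which exceeds
      \<open>n\<close>.\<close>
    also have "\<dots> = (\<Sum>b\<le>n. t b $ n)"
      using True by (intro sum.mono_neutral_left) (auto simp: t_def fps_X_power_mult_nth)
    also have "\<dots> = recip_coeff 1 1 (int s) $ n"
      unfolding recip_coeff_def recip_coeff_sum_def fps_sum_nth fps_nth_Abs_fps
      by (intro sum.cong) (auto simp: t_def nat_add_distrib add_ac)
    finally show ?thesis .
  qed
  show ?thesis
  proof (cases "s \<ge> 0")
    case True
    then show ?thesis using *[of "nat s"] by (simp add: fps_eq_iff)
  next
    case False
    then show ?thesis using *[of "nat (- s)"] by (simp add: fps_eq_iff)
  qed
qed

text \<open>With \<open>h\<close> for \<open>inv_qfac\<close>, the increment of
  \<open>h(N) h(N+s+1)\<close> from N to N+1 is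
  \<open>q^(N+1) h(N+1) h(N+s+1) + q^(N+s+2) h(N+1) h(N+s+2)\<close>. Times \<open>q^s\<close>,
  these are the new terms of the two sums.\<close>

lemma recip_coeff_sum_telescope:
  "recip_coeff_sum 1 0 (int s) N + fps_X ^ s * recip_coeff_sum 1 0 (int (Suc s)) N =
   fps_X ^ s * (inv_qfac (int N) * inv_qfac (int (N + Suc s)))"
proof (induction N)
  case 0
  show ?case using arg_cong[OF inv_qfac_pred[of s], of "(*) (fps_X ^ s)"]
    by (simp add: recip_coeff_sum_def algebra_simps nat_add_distrib)
next
  case (Suc N)
  let ?X = "fps_X :: int fps" and ?h = inv_qfac
  define u where "u = ?h (int (Suc N))"
  define v where "v = ?h (int (Suc N + Suc s))"
  have S: "recip_coeff_sum 1 0 (int s') (Suc N) = recip_coeff_sum 1 0 (int s') N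
    + ?X ^ (Suc N + s') * (u * ?h (int (Suc N + s')))" for s'
    by (simp add: recip_coeff_sum_def nat_add_distrib u_def add_ac)
  have d: "?h (int N) = u - ?X ^ Suc N * u"
    unfolding u_def by (rule inv_qfac_pred)
  have d': "?h (int (N + Suc s)) = v - ?X ^ (Suc N + Suc s) * v"
    using inv_qfac_pred[of "N + Suc s"] by (simp add: v_def)
  have "recip_coeff_sum 1 0 (int s) (Suc N) + ?X ^ s * recip_coeff_sum 1 0 (int (Suc s)) (Suc N)
    = (recip_coeff_sum 1 0 (int s) N + ?X ^ s * recip_coeff_sum 1 0 (int (Suc s)) N)
      + ?X ^ (Suc N + s) * (u * ?h (int (N + Suc s))) + ?X ^ s * (?X ^ (Suc N + Suc s) * (u * v))"
    unfolding S v_def[symmetric] by (simp add: algebra_simps)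
  also have "\<dots> = ?X ^ s * (u * v)"
    unfolding Suc.IH d d' by (simp add: algebra_simps power_add)
  finally show ?case by (simp add: u_def v_def)
qed

section \<open>Extraction of coefficients in \<zeta>\<close>

definition zcoeff :: "int \<Rightarrow> int_laurent_poly fps \<Rightarrow> int fps" where
  "zcoeff s G = Abs_fps (\<lambda>n. Poly_Mapping.lookup (G $ n) s)"

text \<open>Cutting off at |s| \<le> n in degree n makes each coefficient a Laurent polynomial. On
  families supported there, this is inverse to \<open>zcoeff\<close>.\<close>

definition of_zcoeffs :: "(int \<Rightarrow> int fps) \<Rightarrow> int_laurent_poly fps" where
  "of_zcoeffs F = Abs_fps (\<lambda>n. \<Sum>s\<in>{- int n..int n}. Poly_Mapping.single s (F s $ n))"

lemma zcoeff_nth: "zcoeff s G $ n = Poly_Mapping.lookup (G $ n) s"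
  by (simp add: zcoeff_def)

lemma zcoeff_eqI: "(\<And>s. zcoeff s G = zcoeff s H) \<Longrightarrow> G = H"
  by (intro fps_ext poly_mapping_eqI) (simp add: fps_eq_iff zcoeff_nth)

lemma zcoeff_of_zcoeffs:
  assumes "\<And>s n. int n < \<bar>s\<bar> \<Longrightarrow> F s $ n = 0"
  shows "zcoeff s (of_zcoeffs F) = F s"
proof (rule fps_ext)
  fix n
  have "zcoeff s (of_zcoeffs F) $ n = (\<Sum>r\<in>{- int n..int n}. if r = s then F r $ n else 0)"
    by (simp add: zcoeff_nth of_zcoeffs_def lookup_sum lookup_single when_def)
  also have "\<dots> = (if s \<in> {- int n..int n} then F s $ n else 0)"
    by (simp only: sum.delta finite_atLeastAtMost_int)
  also have "\<dots> = F s $ n"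
    using assms[of n s] by auto
  finally show "zcoeff s (of_zcoeffs F) $ n = F s $ n" .
qed

lemma zcoeff_diff: "zcoeff s (G - H) = zcoeff s G - zcoeff s H"
  by (simp add: fps_eq_iff zcoeff_nth lookup_minus)

lemma zcoeff_1: "zcoeff s 1 $ n = (if s = 0 \<and> n = 0 then 1 else 0)"
  by (auto simp: zcoeff_nth lookup_one when_def)

lemma zcoeff_X_power_mult: "zcoeff s (fps_X ^ k * G) = fps_X ^ k * zcoeff s G"
  by (auto simp: fps_eq_iff zcoeff_nth fps_X_power_mult_nth)

lemma lookup_zeta_pow_mult: "Poly_Mapping.lookup (zeta_pow a * p) s = Poly_Mapping.lookup p (s - a)"
proof -
  have "(\<lambda>q. Poly_Mapping.lookup p q when s = a + q) = (\<lambda>q. Poly_Mapping.lookup p q when q = s - a)"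
    by (auto simp: fun_eq_iff when_def)
  then have "Sum_any (\<lambda>q. Poly_Mapping.lookup p q when s = a + q) = Poly_Mapping.lookup p (s - a)"
    by (simp only: Sum_any_when_equal)
  moreover have "Poly_Mapping.lookup (zeta_pow a) l * x = (x when l = a)" for l x
    by (auto simp: zeta_pow_def lookup_single when_def)
  ultimately show ?thesis by (simp add: lookup_mult)
qed

lemma zcoeff_zeta_mult: "zcoeff s (fps_const (zeta_pow a) * G) = zcoeff (s - a) G"
  by (simp add: fps_eq_iff zcoeff_nth lookup_zeta_pow_mult)

abbreviation z_mono :: "int \<Rightarrow> nat \<Rightarrow> int_laurent_poly fps" where
  "z_mono a k \<equiv> fps_const (zeta_pow a) * fps_X ^ k"

lemma zcoeff_z_mono_mult: "zcoeff s (z_mono a k * G) = fps_X ^ k * zcoeff (s - a) G"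
  by (simp add: mult.assoc zcoeff_zeta_mult zcoeff_X_power_mult)

lemma tendsto_zcoeff:
  assumes "G \<longlonglongrightarrow> H"
  shows "(\<lambda>N. zcoeff s (G N)) \<longlonglongrightarrow> zcoeff s H"
proof (rule tendsto_fpsI)
  fix n
  have "\<forall>\<^sub>F N in sequentially. G N $ n = H $ n" using assms by (simp add: tendsto_fps_iff)
  then show "\<forall>\<^sub>F N in sequentially. zcoeff s (G N) $ n = zcoeff s H $ n"
    by eventually_elim (simp add: zcoeff_nth)
qed

text \<open>The factors are free of \<zeta>, so extraction passes through them. The product has
  Laurent polynomial coefficients on the left and integer coefficients on the right.\<close>

lemma zcoeff_qpoch_mult:
  "zcoeff s (qpoch (fps_X ^ i) (fps_X ^ j) n * G) = qpoch (fps_X ^ i) (fps_X ^ j) n * zcoeff s G"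
proof (induction n arbitrary: G)
  case (Suc n)
  have "zcoeff s ((1 - fps_X ^ i * (fps_X ^ j) ^ n) * G) = (1 - fps_X ^ i * (fps_X ^ j) ^ n) * zcoeff s G"
    by (simp add: power_mult[symmetric] power_add[symmetric] left_diff_distrib zcoeff_diff zcoeff_X_power_mult)
  then show ?case by (simp add: qpoch_Suc mult.assoc Suc)
qed simp

lemma zcoeff_qpoch_inf_mult:
  assumes "i \<ge> 1" "j \<ge> 1"
  shows "zcoeff s (qpoch_inf (fps_X ^ i) (fps_X ^ j) * G) = qpoch_inf (fps_X ^ i) (fps_X ^ j) * zcoeff s G"
proof (rule LIMSEQ_unique)
  have "(\<lambda>N. zcoeff s (qpoch (fps_X ^ i) (fps_X ^ j) N * G))
    \<longlonglongrightarrow> zcoeff s (qpoch_inf (fps_X ^ i) (fps_X ^ j) * G)"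
    using assms by (intro tendsto_zcoeff tendsto_fps_mult tendsto_qpoch tendsto_const) simp_all
  then show "(\<lambda>N. qpoch (fps_X ^ i) (fps_X ^ j) N * zcoeff s G)
    \<longlonglongrightarrow> zcoeff s (qpoch_inf (fps_X ^ i) (fps_X ^ j) * G)"
    by (simp add: zcoeff_qpoch_mult)
  show "(\<lambda>N. qpoch (fps_X ^ i) (fps_X ^ j) N * zcoeff s G)
    \<longlonglongrightarrow> qpoch_inf (fps_X ^ i) (fps_X ^ j) * zcoeff s G"
    using assms by (intro tendsto_fps_mult tendsto_qpoch tendsto_const) simp_all
qed

lemma zcoeff_recip_coeff:
  "i \<ge> 1 \<Longrightarrow> j \<ge> 1 \<Longrightarrow> zcoeff s (of_zcoeffs (recip_coeff i j)) = recip_coeff i j s"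
  by (rule zcoeff_of_zcoeffs) (simp add: recip_coeff_eq_0)

lemma recip_coeff_mult:
  assumes "i \<ge> 1" "j \<ge> 1"
  shows "of_zcoeffs (recip_coeff i j) * ((1 - z_mono 1 i) * (1 - z_mono (- 1) j)) =
    of_zcoeffs (recip_coeff (Suc i) (Suc j))"
proof -
  have "(1 - z_mono 1 i) * of_zcoeffs (recip_coeff i j) = of_zcoeffs (recip_coeff (Suc i) j)"
    using assms recip_coeff_left[of j i]
    by (intro zcoeff_eqI) (simp add: left_diff_distrib zcoeff_diff zcoeff_z_mono_mult zcoeff_recip_coeff)
  moreover have "(1 - z_mono (- 1) j) * of_zcoeffs (recip_coeff (Suc i) j) = of_zcoeffs (recip_coeff (Suc i) (Suc j))"
    using assms recip_coeff_right[of j "Suc i"]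
    by (intro zcoeff_eqI) (simp add: left_diff_distrib zcoeff_diff zcoeff_z_mono_mult zcoeff_recip_coeff)
  moreover have "of_zcoeffs (recip_coeff i j) * ((1 - z_mono 1 i) * (1 - z_mono (- 1) j)) =
    (1 - z_mono (- 1) j) * ((1 - z_mono 1 i) * of_zcoeffs (recip_coeff i j))"
    by (simp only: mult_ac)
  ultimately show ?thesis by simp
qed

lemma recip_coeff_mult_qpoch:
  "of_zcoeffs (recip_coeff 1 1) * (qpoch (fps_const (zeta_pow 1) * fps_X) fps_X N *
     qpoch (fps_const (zeta_pow (- 1)) * fps_X) fps_X N) = of_zcoeffs (recip_coeff (Suc N) (Suc N))"
proof (induction N)
  case (Suc N)
  show ?case
    unfolding recip_coeff_mult[of "Suc N" "Suc N", simplified, symmetric] Suc[symmetric]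
    by (simp add: qpoch_Suc mult_ac)
qed (simp only: qpoch_0 mult_1_right One_nat_def)

lemma tendsto_recip_coeff: "(\<lambda>N. of_zcoeffs (recip_coeff (Suc N) (Suc N))) \<longlonglongrightarrow> 1"
proof (rule tendsto_fpsI)
  fix n
  show "\<forall>\<^sub>F N in sequentially. of_zcoeffs (recip_coeff (Suc N) (Suc N)) $ n = 1 $ n"
    using eventually_ge_at_top[of n]
  proof eventually_elim
    case (elim N)
    then have "zcoeff s (of_zcoeffs (recip_coeff (Suc N) (Suc N))) $ n = zcoeff s 1 $ n" for s
      using recip_coeff_large[of n "Suc N" s] by (simp add: zcoeff_recip_coeff zcoeff_1)
    then show ?case by (intro poly_mapping_eqI) (simp add: zcoeff_nth)
  qed
qed

text \<open>This justifies the Euler expansion: cancelling N factors of each product raises both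
  indices of \<open>recip_coeff\<close> from 1 to N + 1, and the result tends to 1.\<close>

lemma recip_coeff_mult_qpoch_inf:
  "of_zcoeffs (recip_coeff 1 1) * (qpoch_inf (fps_const (zeta_pow 1) * fps_X) fps_X *
     qpoch_inf (fps_const (zeta_pow (- 1)) * fps_X) fps_X) = 1"
proof (rule LIMSEQ_unique)
  show "(\<lambda>N. of_zcoeffs (recip_coeff 1 1) * (qpoch (fps_const (zeta_pow 1) * fps_X) fps_X N *
     qpoch (fps_const (zeta_pow (- 1)) * fps_X) fps_X N)) \<longlonglongrightarrow>
     of_zcoeffs (recip_coeff 1 1) * (qpoch_inf (fps_const (zeta_pow 1) * fps_X) fps_X *
     qpoch_inf (fps_const (zeta_pow (- 1)) * fps_X) fps_X)"
    by (intro tendsto_fps_mult tendsto_qpoch tendsto_const) simp_all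
  show "(\<lambda>N. of_zcoeffs (recip_coeff 1 1) * (qpoch (fps_const (zeta_pow 1) * fps_X) fps_X N *
     qpoch (fps_const (zeta_pow (- 1)) * fps_X) fps_X N)) \<longlonglongrightarrow> 1"
    unfolding recip_coeff_mult_qpoch by (rule tendsto_recip_coeff)
qed

lemma crank_gf_eq_recip_coeff: "crank_gf = qpoch_inf fps_X fps_X * of_zcoeffs (recip_coeff 1 1)"
  using crank_gf recip_coeff_mult_qpoch_inf by (rule eq_mult_of_mult_eq_1)

lemma zcoeff_crank_gf: "zcoeff s crank_gf = qpoch_inf fps_X fps_X * recip_coeff 1 1 s"
  using zcoeff_qpoch_inf_mult[of 1 1 s "of_zcoeffs (recip_coeff 1 1)"]
  by (simp add: crank_gf_eq_recip_coeff zcoeff_recip_coeff)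

lemma crank_count_eq: "crank_count s n = zcoeff s crank_gf $ n"
  by (simp add: crank_count_def zcoeff_nth)

lemma crank_count_minus: "crank_count (- s) n = crank_count s n"
  by (simp add: crank_count_eq zcoeff_crank_gf recip_coeff_symmetric[simplified])

lemma crank_count_eq_0:
  assumes "int n < \<bar>s\<bar>"
  shows "crank_count s n = 0"
  unfolding crank_count_eq zcoeff_crank_gf fps_mult_nth
  using assms by (intro sum.neutral ballI) (simp add: recip_coeff_eq_0[simplified])

subsection \<open>Partitions\<close>

text \<open>A nonzero entry at \<open>i\<close> forces \<open>i + 1\<close> nonzero entries, whose
  sum is larger than \<open>n\<close>.\<close>

lemma partition_of_vanishes:
  assumes "partition_of f n" "n \<le> i"
  shows "f i = 0"
proof (rule ccontr)
  assume "f i \<noteq> 0"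
  have dec: "decseq f" and fin: "finite {i. f i \<noteq> 0}" and n: "(\<Sum>i | f i \<noteq> 0. f i) = n"
    using assms by (auto simp: partition_of_def)
  have pos: "f j \<noteq> 0" if "j \<le> i" for j
    using decseqD[OF dec that] \<open>f i \<noteq> 0\<close> by simp
  have "Suc i = (\<Sum>j\<le>i. 1)" by simp
  also have "\<dots> \<le> (\<Sum>j\<le>i. f j)" using pos by (intro sum_mono) (simp add: Suc_leI)
  also have "\<dots> \<le> n" unfolding n[symmetric] using pos fin by (intro sum_mono2) auto
  finally show False using assms by simp
qed

lemma partition_of_iff:
  assumes "\<And>i. k \<le> i \<Longrightarrow> f i = 0"
  shows "partition_of f n \<longleftrightarrow> decseq f \<and> (\<Sum>i<k. f i) = n"
proof -
  have sub: "{i. f i \<noteq> 0} \<subseteq> {..<k}" using assms by (force simp: not_le)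
  then have "(\<Sum>i | f i \<noteq> 0. f i) = (\<Sum>i<k. f i)" by (intro sum.mono_neutral_left) auto
  then show ?thesis using finite_subset[OF sub] by (auto simp: partition_of_def)
qed

lemma partition_of_sum: "partition_of f n \<Longrightarrow> n \<le> k \<Longrightarrow> (\<Sum>i<k. f i) = n"
  using partition_of_iff[of k f n] partition_of_vanishes[of f n] by auto

lemma partition_of_0_iff: "partition_of f 0 \<longleftrightarrow> f = (\<lambda>_. 0)"
proof
  assume "partition_of f 0"
  then show "f = (\<lambda>_. 0)" using partition_of_vanishes[of f 0] by (simp add: fun_eq_iff)
qed (simp add: partition_of_def decseq_def)

text \<open>In terms of Young diagrams, a column of length \<open>u\<close> is inserted.\<close>

definition raise :: "nat \<Rightarrow> (nat \<Rightarrow> nat) \<Rightarrow> nat \<Rightarrow> nat" where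
  "raise u f = (\<lambda>i. if i < u then Suc (f i) else f i)"

lemma inj_raise: "inj (raise u)"
proof (rule injI)
  fix f g assume eq: "raise u f = raise u g"
  show "f = g"
  proof
    fix i show "f i = g i" using fun_cong[OF eq, of i] by (simp add: raise_def split: if_splits)
  qed
qed

lemma partition_of_raise:
  assumes "decseq f"
  shows "partition_of (raise u f) n \<longleftrightarrow> u \<le> n \<and> partition_of f (n - u)"
proof -
  have dec: "decseq (raise u f)" using assms by (auto simp: decseq_def raise_def le_SucI)
  \<comment> \<open>The range \<open>k\<close> has to cover the new column and the support of
    \<open>f\<close>. In one direction \<open>max u n\<close> does; in the other,
    \<open>u \<le> n\<close> makes \<open>n\<close> sufficient.\<close>
  have iff: "partition_of (raise u f) n \<longleftrightarrow> u \<le> n \<and> partition_of f (n - u)"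
    if k: "u \<le> k" "\<And>i. k \<le> i \<Longrightarrow> f i = 0" for k
  proof -
    have "(\<Sum>i<k. raise u f i) = (\<Sum>i<k. f i + (if i < u then 1 else 0))"
      by (intro sum.cong) (auto simp: raise_def)
    also have "\<dots> = (\<Sum>i<k. f i) + card {i. i < k \<and> i < u}"
      by (simp add: sum.distrib flip: sum.inter_filter)
    also have "{i. i < k \<and> i < u} = {..<u}" using k by auto
    finally have "(\<Sum>i<k. raise u f i) = (\<Sum>i<k. f i) + u" by simp
    moreover have "raise u f i = 0" if "k \<le> i" for i using k that by (simp add: raise_def)
    ultimately show ?thesis using dec assms k by (auto simp: partition_of_iff[of k])
  qed
  show ?thesis
  proof
    assume L: "partition_of (raise u f) n"
    have "f i = 0" if "max u n \<le> i" for i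
      using partition_of_vanishes[OF L, of i] that by (simp add: raise_def)
    with iff[of "max u n"] L show "u \<le> n \<and> partition_of f (n - u)" by simp
  next
    assume R: "u \<le> n \<and> partition_of f (n - u)"
    then have "f i = 0" if "n \<le> i" for i using partition_of_vanishes[of f "n - u" i] that by auto
    with iff[of n] R show "partition_of (raise u f) n" by simp
  qed
qed

text \<open>Removing the first column of a Young diagram turns a partition with exactly \<open>u\<close> rows
  into one with at most \<open>u\<close> rows.\<close>

lemma raise_lower:
  assumes "\<And>i. 0 < f i \<longleftrightarrow> i < u"
  shows "raise u (\<lambda>i. f i - 1) = f"
proof
  fix i show "raise u (\<lambda>i. f i - 1) i = f i" using assms[of i] by (auto simp: raise_def)
qed

definition partitions_upto :: "nat \<Rightarrow> nat \<Rightarrow> (nat \<Rightarrow> nat) set" where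
  "partitions_upto k n = {f. partition_of f n \<and> (\<forall>i\<ge>k. f i = 0)}"

lemma finite_partitions_upto: "finite (partitions_upto k n)"
  by (rule finite_subset[OF _ finite_partitions[of n]]) (auto simp: partitions_upto_def)

text \<open>A partition with at most k + 1 rows has at most k rows or exactly k + 1; the latter form
  \<open>E\<close> and lose their first column.\<close>

lemma card_partitions_upto_Suc:
  "card (partitions_upto (Suc k) n) = card (partitions_upto k n)
     + (if Suc k \<le> n then card (partitions_upto (Suc k) (n - Suc k)) else 0)"
proof -
  define E where "E = {f. partition_of f n \<and> (\<forall>i. 0 < f i \<longleftrightarrow> i < Suc k)}"
  have E: "E = (if Suc k \<le> n then raise (Suc k) ` partitions_upto (Suc k) (n - Suc k) else {})"
  proof -
    have "f \<in> E \<longleftrightarrow> Suc k \<le> n \<and> f \<in> raise (Suc k) ` partitions_upto (Suc k) (n - Suc k)" for f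
    proof
      assume f: "f \<in> E"
      then have r: "raise (Suc k) (\<lambda>i. f i - 1) = f"
        unfolding E_def by (intro raise_lower) blast
      have "decseq f" using f by (simp add: E_def partition_of_def)
      then have "decseq (\<lambda>i. f i - 1)" by (simp add: decseq_def diff_le_mono)
      then have "Suc k \<le> n \<and> partition_of (\<lambda>i. f i - 1) (n - Suc k)"
        using f by (subst partition_of_raise[symmetric]) (simp_all only: r E_def mem_Collect_eq)
      moreover have "f i - 1 = 0" if "i \<ge> Suc k" for i
      proof -
        have "\<not> 0 < f i" using f that by (auto simp: E_def)
        then show ?thesis by simp
      qed
      ultimately have "Suc k \<le> n" "(\<lambda>i. f i - 1) \<in> partitions_upto (Suc k) (n - Suc k)"
        by (simp_all add: partitions_upto_def)
      with imageI[OF this(2), of "raise (Suc k)"]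
      show "Suc k \<le> n \<and> f \<in> raise (Suc k) ` partitions_upto (Suc k) (n - Suc k)"
        unfolding r by blast
    next
      assume "Suc k \<le> n \<and> f \<in> raise (Suc k) ` partitions_upto (Suc k) (n - Suc k)"
      then obtain g where g: "f = raise (Suc k) g" "partition_of g (n - Suc k)"
        "\<forall>i\<ge>Suc k. g i = 0" "Suc k \<le> n" by (auto simp: partitions_upto_def)
      then have "decseq g" by (simp add: partition_of_def)
      then have "partition_of f n" using g by (simp add: partition_of_raise)
      then show "f \<in> E" using g by (auto simp: E_def raise_def)
    qed
    then show ?thesis by auto
  qed
  have "partitions_upto (Suc k) n = partitions_upto k n \<union> E"
  proof (intro set_eqI iffI)
    fix f assume f: "f \<in> partitions_upto (Suc k) n"
    show "f \<in> partitions_upto k n \<union> E"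
    proof (cases "f k = 0")
      case True
      then have "\<forall>i\<ge>k. f i = 0" using f
        by (auto simp: partitions_upto_def Suc_le_eq dest: le_neq_implies_less)
      then show ?thesis using f by (simp add: partitions_upto_def)
    next
      case False
      have "0 < f i" if "i < Suc k" for i
        using decseqD[of f i k] f that False by (simp add: partitions_upto_def partition_of_def)
      moreover have "f i = 0" if "\<not> i < Suc k" for i
        using f that by (simp add: partitions_upto_def)
      ultimately have "\<forall>i. 0 < f i \<longleftrightarrow> i < Suc k" by (metis less_irrefl)
      moreover have "partition_of f n" using f by (simp add: partitions_upto_def)
      ultimately show ?thesis unfolding E_def by blast
    qed
  next
    fix f assume "f \<in> partitions_upto k n \<union> E"
    then have "partition_of f n \<and> (\<forall>i\<ge>Suc k. f i = 0)"
    proof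
      assume f: "f \<in> E"
      have "f i = 0" if "i \<ge> Suc k" for i
      proof -
        have "0 < f i \<longleftrightarrow> i < Suc k" using f unfolding E_def by blast
        then show ?thesis using that by simp
      qed
      then show ?thesis using f unfolding E_def by blast
    qed (simp add: partitions_upto_def)
    then show "f \<in> partitions_upto (Suc k) n" by (simp add: partitions_upto_def)
  qed
  moreover have "partitions_upto k n \<inter> E = {}"
  proof -
    have False if "f \<in> partitions_upto k n" "f \<in> E" for f
    proof -
      have "f k = 0" using that(1) by (simp add: partitions_upto_def)
      moreover have "0 < f k" using that(2) unfolding E_def by blast
      ultimately show False by simp
    qed
    then show ?thesis by blast
  qed
  moreover have "finite E" by (simp add: E finite_partitions_upto)
  ultimately have "card (partitions_upto (Suc k) n) = card (partitions_upto k n) + card E"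
    by (simp add: card_Un_disjoint finite_partitions_upto)
  also have "card E = (if Suc k \<le> n then card (partitions_upto (Suc k) (n - Suc k)) else 0)"
    by (simp add: E card_image inj_on_subset[OF inj_raise])
  finally show ?thesis .
qed

definition partition_gf :: "int fps" where
  "partition_gf = Abs_fps (\<lambda>n. int (num_partitions (int n)))"

text \<open>The preceding count says \<open>(1 - q^(k+1)) P(k+1) = P(k)\<close>, which together with
  \<open>P(0) = 1\<close> determines \<open>1/(q;q)\<close> with k factors.\<close>

lemma inv_qfac_eq_partitions_upto: "inv_qfac (int k) $ n = int (card (partitions_upto k n))"
proof -
  define P where "P k = Abs_fps (\<lambda>n. int (card (partitions_upto k n)))" for k
  have "qpoch fps_X fps_X k * P k = 1"
  proof (induction k)
    case 0
    have "P 0 = 1"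
    proof (rule fps_ext)
      fix n
      have "f \<in> partitions_upto 0 n \<longleftrightarrow> n = 0 \<and> f = (\<lambda>_. 0)" for f
        by (auto simp: partitions_upto_def partition_of_0_iff fun_eq_iff partition_of_iff[of 0] decseq_def)
      then have "partitions_upto 0 n = (if n = 0 then {\<lambda>_. 0} else {})"
        by auto
      then show "P 0 $ n = 1 $ n" by (simp add: P_def)
    qed
    then show ?case by simp
  next
    case (Suc k)
    have "(1 - fps_X ^ Suc k) * P (Suc k) = P k"
      by (rule fps_ext)
        (use card_partitions_upto_Suc[of k] in
          \<open>auto simp: P_def left_diff_distrib fps_X_power_mult_nth simp del: power_Suc\<close>)
    then show ?case using Suc by (simp add: qpoch_Suc mult.assoc)
  qed
  then have "P k = 1 * inv_qfac (int k)"
    using qpoch_mult_inv_qfac[of k] by (intro eq_mult_of_mult_eq_1[of _ "qpoch fps_X fps_X k"]) (simp_all only: mult_ac)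
  then show ?thesis by (simp add: P_def fps_eq_iff)
qed

lemma tendsto_inv_qfac: "(\<lambda>k. inv_qfac (int k)) \<longlonglongrightarrow> partition_gf"
proof (rule tendsto_fpsI)
  fix n
  show "\<forall>\<^sub>F k in sequentially. inv_qfac (int k) $ n = partition_gf $ n"
    using eventually_ge_at_top[of n]
  proof eventually_elim
    case (elim k)
    then have "partitions_upto k n = {f. partition_of f n}"
      using partition_of_vanishes by (fastforce simp: partitions_upto_def)
    then show ?case
      by (simp add: inv_qfac_eq_partitions_upto partition_gf_def num_partitions_def)
  qed
qed

lemma qpoch_inf_mult_partition_gf: "qpoch_inf fps_X fps_X * partition_gf = 1"
proof (rule LIMSEQ_unique)
  show "(\<lambda>k. qpoch fps_X fps_X k * inv_qfac (int k)) \<longlonglongrightarrow> qpoch_inf fps_X fps_X * partition_gf"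
    by (intro tendsto_fps_mult tendsto_qpoch tendsto_inv_qfac) simp_all
  show "(\<lambda>k. qpoch fps_X fps_X k * inv_qfac (int k)) \<longlonglongrightarrow> 1"
    by (simp add: qpoch_mult_inv_qfac)
qed

subsection \<open>Steadily decreasing pairs\<close>

text \<open>Integer weights with value 0 below zero allow column lengths to be subtracted without
  truncation.\<close>

definition count_pairs :: "((nat \<Rightarrow> nat) \<Rightarrow> (nat \<Rightarrow> nat) \<Rightarrow> bool) \<Rightarrow> int \<Rightarrow> int \<Rightarrow> nat" where
  "count_pairs R m n = (if m < 0 \<or> n < 0 then 0 else card {(f, g). partition_of f (nat m) \<and>
     partition_of g (nat n) \<and> steadily_decreasing f g \<and> R f g})"

lemma steadily_decreasing_imp_decseq:
  "steadily_decreasing f g \<Longrightarrow> decseq f \<and> decseq g"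
  by (auto simp: steadily_decreasing_def decseq_Suc_iff)

lemma finite_pairs: "finite {(f, g). partition_of f m \<and> partition_of g n \<and> steadily_decreasing f g \<and> R f g}"
  by (rule finite_subset[OF _ finite_steady_pairs[of m n]]) auto

lemma count_pairs_cong:
  assumes "\<And>f g. steadily_decreasing f g \<Longrightarrow> partition_of f (nat m) \<Longrightarrow> partition_of g (nat n) \<Longrightarrow> R f g \<longleftrightarrow> R' f g"
  shows "count_pairs R m n = count_pairs R' m n"
proof -
  have "{(f, g). partition_of f (nat m) \<and> partition_of g (nat n) \<and> steadily_decreasing f g \<and> R f g} =
    {(f, g). partition_of f (nat m) \<and> partition_of g (nat n) \<and> steadily_decreasing f g \<and> R' f g}"
    using assms by auto
  then show ?thesis by (simp add: count_pairs_def)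
qed

lemma count_pairs_disj:
  assumes "\<And>f g. steadily_decreasing f g \<Longrightarrow> R f g \<longleftrightarrow> R1 f g \<or> R2 f g"
    and "\<And>f g. R1 f g \<Longrightarrow> \<not> R2 f g"
  shows "count_pairs R m n = count_pairs R1 m n + count_pairs R2 m n"
proof -
  have "{(f, g). partition_of f (nat m) \<and> partition_of g (nat n) \<and> steadily_decreasing f g \<and> R f g} =
    {(f, g). partition_of f (nat m) \<and> partition_of g (nat n) \<and> steadily_decreasing f g \<and> R1 f g} \<union>
    {(f, g). partition_of f (nat m) \<and> partition_of g (nat n) \<and> steadily_decreasing f g \<and> R2 f g}"
    using assms(1) by auto
  moreover have "card \<dots> =
    card {(f, g). partition_of f (nat m) \<and> partition_of g (nat n) \<and> steadily_decreasing f g \<and> R1 f g} +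
    card {(f, g). partition_of f (nat m) \<and> partition_of g (nat n) \<and> steadily_decreasing f g \<and> R2 f g}"
    using assms(2) by (intro card_Un_disjoint finite_pairs) auto
  ultimately show ?thesis by (simp add: count_pairs_def)
qed

text \<open>\<open>raise u\<close> and \<open>raise v\<close> together give a bijection of the two
  sets. If a column is longer than the weight permits, both counts are 0, the right one by the
  default value.\<close>

lemma count_pairs_raise:
  assumes lower: "\<And>f g. steadily_decreasing f g \<Longrightarrow> R f g \<Longrightarrow>
      \<exists>f' g'. f = raise u f' \<and> g = raise v g' \<and> steadily_decreasing f' g' \<and> R' f' g'"
    and raise: "\<And>f g. steadily_decreasing f g \<Longrightarrow> R' f g \<Longrightarrow>
      steadily_decreasing (raise u f) (raise v g) \<and> R (raise u f) (raise v g)"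
  shows "count_pairs R m n = count_pairs R' (m - int u) (n - int v)"
proof (cases "m < 0 \<or> n < 0")
  case True
  then show ?thesis by (auto simp: count_pairs_def)
next
  case False
  define M where "M = nat m"
  define N where "N = nat n"
  have m: "m = int M" "n = int N" using False by (simp_all add: M_def N_def)
  define A where "A = {(f, g). partition_of f M \<and> partition_of g N \<and> steadily_decreasing f g \<and> R f g}"
  define A' where "A' = {(f, g). partition_of f (M - u) \<and> partition_of g (N - v) \<and> steadily_decreasing f g \<and> R' f g}"
  have sub: "u \<le> M \<and> v \<le> N \<and> p \<in> map_prod (raise u) (raise v) ` A'" if p: "p \<in> A" for p
  proof -
    obtain f g where fg: "p = (f, g)" "partition_of f M" "partition_of g N" "steadily_decreasing f g" "R f g"
      using p by (auto simp: A_def)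
    obtain f' g' where fg': "f = raise u f'" "g = raise v g'" "steadily_decreasing f' g'" "R' f' g'"
      using lower[OF fg(4,5)] by blast
    have "u \<le> M \<and> partition_of f' (M - u)" "v \<le> N \<and> partition_of g' (N - v)"
      using fg fg' steadily_decreasing_imp_decseq[OF fg'(3)] by (simp_all add: partition_of_raise)
    then show ?thesis using fg(1) fg' by (auto simp: A'_def intro!: rev_image_eqI[of "(f', g')"])
  qed
  show ?thesis
  proof (cases "u \<le> M \<and> v \<le> N")
    case False
    then have "A = {}" using sub by auto
    then have "count_pairs R m n = 0"
      unfolding count_pairs_def m nat_int A_def[symmetric] by simp
    moreover have "count_pairs R' (m - int u) (n - int v) = 0"
      using False by (auto simp: count_pairs_def m)
    ultimately show ?thesis by simp
  next
    case True
    have "map_prod (raise u) (raise v) ` A' \<subseteq> A"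
    proof (rule image_subsetI)
      fix p assume "p \<in> A'"
      then obtain f g where p: "p = (f, g)" and fg: "partition_of f (M - u)" "partition_of g (N - v)"
        "steadily_decreasing f g" "R' f g" by (auto simp: A'_def)
      then show "map_prod (raise u) (raise v) p \<in> A"
        using raise[OF fg(3,4)] steadily_decreasing_imp_decseq[OF fg(3)] True
        by (simp add: A_def partition_of_raise)
    qed
    then have "A = map_prod (raise u) (raise v) ` A'" using sub by blast
    then have "card A = card A'"
      by (simp add: card_image inj_on_subset[OF prod.inj_map[OF inj_raise inj_raise]])
    then show ?thesis using True
      unfolding count_pairs_def m A_def A'_def by (simp flip: of_nat_diff)
  qed
qed

text \<open>A pair of partitions of \<open>m\<close> and \<open>n\<close> is weighted by \<open>\<zeta>\<^bsup>m-n\<^esup> q\<^bsup>n\<^esup>\<close>, that is,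
  \<open>x\<^sup>m y\<^sup>n\<close> with \<open>x = \<zeta>\<close> and \<open>y = q / \<zeta>\<close>. The coefficients are Laurent polynomials only if the
  first weight is bounded in terms of the second one, as for the tight pairs defined next.\<close>

definition pair_gf :: "((nat \<Rightarrow> nat) \<Rightarrow> (nat \<Rightarrow> nat) \<Rightarrow> bool) \<Rightarrow> int_laurent_poly fps" where
  "pair_gf R = of_zcoeffs (\<lambda>s. Abs_fps (\<lambda>n. int (count_pairs R (int n + s) (int n))))"

text \<open>Enlarging the first part of the first partition by one is an injection on steadily
  decreasing pairs; the tight pairs are those outside its range. They are counted by
  \<^const>\<open>D_diff\<close>.\<close>

definition tight :: "(nat \<Rightarrow> nat) \<Rightarrow> (nat \<Rightarrow> nat) \<Rightarrow> bool" where
  "tight f g \<longleftrightarrow> f 0 = max (f 1) (g 1)"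

text \<open>\<open>pair_gf (tight_within k k)\<close> is the series \<open>D\<^sub>k\<close>. The
  two bounds are separate because removing a partly filled last row leads to pairs with k + 1 rows
  on one side only.\<close>

definition tight_within :: "nat \<Rightarrow> nat \<Rightarrow> (nat \<Rightarrow> nat) \<Rightarrow> (nat \<Rightarrow> nat) \<Rightarrow> bool" where
  "tight_within u v f g \<longleftrightarrow> tight f g \<and> (\<forall>i\<ge>u. f i = 0) \<and> (\<forall>i\<ge>v. g i = 0)"

definition tight_exact :: "nat \<Rightarrow> nat \<Rightarrow> (nat \<Rightarrow> nat) \<Rightarrow> (nat \<Rightarrow> nat) \<Rightarrow> bool" where
  "tight_exact u v f g \<longleftrightarrow> tight f g \<and> (\<forall>i. 0 < f i \<longleftrightarrow> i < u) \<and> (\<forall>i. 0 < g i \<longleftrightarrow> i < v)"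

lemma tight_within_imp: "tight_within u v f g \<Longrightarrow> tight f g"
  and tight_exact_imp: "tight_exact u v f g \<Longrightarrow> tight f g"
  by (simp_all add: tight_within_def tight_exact_def)

text \<open>From \<open>f (Suc i) \<le> g i\<close>, the parts of \<open>f\<close> after the first
  add up to at most \<open>n\<close>; tightness gives \<open>f 0 \<le> g 0 \<le> n\<close>.\<close>

lemma tight_weight_le:
  assumes "steadily_decreasing f g" "tight f g" "partition_of f m" "partition_of g n"
  shows "m \<le> 2 * n"
proof -
  define k where "k = Suc (max m n)"
  have sd: "f (Suc i) \<le> g i" "g (Suc i) \<le> g i" for i
    using assms(1) unfolding steadily_decreasing_def by (metis max.bounded_iff min.bounded_iff)+
  have "m = (\<Sum>i<Suc k. f i)"
    using assms by (simp only: partition_of_sum k_def)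
  also have "\<dots> = f 0 + (\<Sum>i<k. f (Suc i))"
    by (rule sum.lessThan_Suc_shift)
  also have "(\<Sum>i<k. f (Suc i)) \<le> (\<Sum>i<k. g i)"
    by (rule sum_mono) (rule sd)
  also have "(\<Sum>i<k. g i) = n"
    using assms by (simp only: partition_of_sum k_def)
  also have "f 0 \<le> g 0"
    using assms(2) sd[of 0] by (simp add: tight_def)
  also have "g 0 \<le> (\<Sum>i<k. g i)"
    by (rule member_le_sum) (simp_all add: k_def)
  also have "(\<Sum>i<k. g i) = n"
    using assms by (simp only: partition_of_sum k_def)
  finally show ?thesis by simp
qed

lemma count_pairs_tight_eq_0:
  assumes "\<And>f g. R f g \<Longrightarrow> tight f g" and "2 * n < m"
  shows "count_pairs R m n = 0"
proof (cases "m < 0 \<or> n < 0")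
  case False
  then have "\<not> nat m \<le> 2 * nat n" using assms by linarith
  then have "{(f, g). partition_of f (nat m) \<and> partition_of g (nat n) \<and> steadily_decreasing f g \<and> R f g} = {}"
    using tight_weight_le assms(1) by blast
  then show ?thesis unfolding count_pairs_def by (simp only: card.empty if_cancel)
qed (simp add: count_pairs_def)

lemma zcoeff_pair_gf:
  assumes "\<And>f g. R f g \<Longrightarrow> tight f g"
  shows "zcoeff s (pair_gf R) = Abs_fps (\<lambda>n. int (count_pairs R (int n + s) (int n)))"
  unfolding pair_gf_def
proof (rule zcoeff_of_zcoeffs)
  fix s n assume "int n < \<bar>s\<bar>"
  \<comment> \<open>For s > n the weight bound applies; for s < -n the first weight is
    negative.\<close>
  then have "count_pairs R (int n + s) (int n) = 0"
    using count_pairs_tight_eq_0[of R "int n" "int n + s"] assms by (auto simp: count_pairs_def)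
  then show "Abs_fps (\<lambda>n. int (count_pairs R (int n + s) (int n))) $ n = 0" by simp
qed

section \<open>Recursion in the number of rows\<close>

lemma pair_gf_disj:
  assumes "\<And>f g. steadily_decreasing f g \<Longrightarrow> R f g \<longleftrightarrow> R1 f g \<or> R2 f g"
    and "\<And>f g. R1 f g \<Longrightarrow> \<not> R2 f g"
  shows "pair_gf R = pair_gf R1 + pair_gf R2"
  unfolding pair_gf_def
  by (simp add: of_zcoeffs_def fps_eq_iff count_pairs_disj[OF assms] single_add sum.distrib)

text \<open>As \<open>u\<close> and \<open>v\<close> differ by at most one, raising an entry of row
  i + 1 on either side means that both entries of row i are raised.\<close>

lemma steadily_decreasing_raise:
  assumes "steadily_decreasing f g" "u \<le> Suc v" "v \<le> Suc u"
  shows "steadily_decreasing (raise u f) (raise v g)"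
  unfolding steadily_decreasing_def
proof
  fix i
  have "max (f (Suc i)) (g (Suc i)) \<le> min (f i) (g i)"
    using assms(1) by (simp add: steadily_decreasing_def)
  then show "max (raise u f (Suc i)) (raise v g (Suc i)) \<le> min (raise u f i) (raise v g i)"
    using assms(2,3) by (simp add: raise_def)
qed

lemma steadily_decreasing_lower:
  assumes "steadily_decreasing f g"
  shows "steadily_decreasing (\<lambda>i. f i - 1) (\<lambda>i. g i - 1)"
  unfolding steadily_decreasing_def
proof
  fix i
  have "max (f (Suc i)) (g (Suc i)) \<le> min (f i) (g i)"
    using assms(1) by (simp add: steadily_decreasing_def)
  then show "max (f (Suc i) - 1) (g (Suc i) - 1) \<le> min (f i - 1) (g i - 1)"
    by (simp add: diff_le_mono)
qed

text \<open>Removing the first columns, of lengths \<open>u\<close> and \<open>v\<close>, takes away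
  the weight \<open>x^u y^v = \<zeta>^(u-v) q^v\<close>.\<close>

lemma pair_gf_tight_exact:
  assumes "u \<le> Suc v" "v \<le> Suc u" "u = 0 \<or> 2 \<le> u \<or> 2 \<le> v"
  shows "pair_gf (tight_exact u v) = z_mono (int u - int v) v * pair_gf (tight_within u v)"
proof (rule zcoeff_eqI, rule fps_ext)
  fix s n
  have c: "count_pairs (tight_exact u v) m n = count_pairs (tight_within u v) (m - int u) (n - int v)" for m n
  proof (rule count_pairs_raise)
    fix f g assume fg: "steadily_decreasing f g" "tight_exact u v f g"
    have ef: "0 < f i \<longleftrightarrow> i < u" and eg: "0 < g i \<longleftrightarrow> i < v" for i
      using fg(2) by (simp_all add: tight_exact_def)
    have "f = raise u (\<lambda>i. f i - 1)" "g = raise v (\<lambda>i. g i - 1)"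
      using raise_lower[of f u, OF ef] raise_lower[of g v, OF eg] by simp_all
    moreover have "f i - 1 = 0" if "u \<le> i" for i
      using ef[of i] that by linarith
    moreover have "g i - 1 = 0" if "v \<le> i" for i
      using eg[of i] that by linarith
    moreover have "tight (\<lambda>i. f i - 1) (\<lambda>i. g i - 1)"
      using fg(2) by (auto simp: tight_exact_def tight_def)
    ultimately show "\<exists>f' g'. f = raise u f' \<and> g = raise v g' \<and> steadily_decreasing f' g' \<and> tight_within u v f' g'"
      using steadily_decreasing_lower[OF fg(1)] unfolding tight_within_def by blast
  next
    fix f g assume fg: "steadily_decreasing f g" "tight_within u v f g"
    \<comment> \<open>If \<open>f 0\<close> is raised, the third assumption ensures that an entry of
      row 1 is raised too. An entry of row 1 that is not raised is zero.\<close>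
    have "tight (raise u f) (raise v g)"
      using fg(2) assms by (auto simp: tight_def tight_within_def raise_def max_def)
    then have "tight_exact u v (raise u f) (raise v g)"
      using fg(2) by (auto simp: tight_exact_def tight_within_def raise_def)
    then show "steadily_decreasing (raise u f) (raise v g) \<and> tight_exact u v (raise u f) (raise v g)"
      using steadily_decreasing_raise[OF fg(1) assms(1,2)] by blast
  qed
  show "zcoeff s (pair_gf (tight_exact u v)) $ n = zcoeff s (z_mono (int u - int v) v * pair_gf (tight_within u v)) $ n"
  proof (cases "n < v")
    \<comment> \<open>Below degree \<open>v\<close> both sides vanish, the left one because
      \<open>n - v\<close> is negative as an integer.\<close>
    case True
    then show ?thesis
      by (simp add: zcoeff_z_mono_mult zcoeff_pair_gf[OF tight_within_imp] zcoeff_pair_gf[OF tight_exact_imp]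
        fps_X_power_mult_nth c) (simp add: count_pairs_def)
  next
    case False
    then have "int (n - v) + (s - (int u - int v)) = int n + s - int u" "int (n - v) = int n - int v"
      by simp_all
    with False show ?thesis
      by (simp add: zcoeff_z_mono_mult zcoeff_pair_gf[OF tight_within_imp] zcoeff_pair_gf[OF tight_exact_imp]
        fps_X_power_mult_nth c add_diff_eq)
  qed
qed

lemma all_ge_iff: "(\<forall>i\<ge>k. P i) \<longleftrightarrow> P k \<and> (\<forall>i\<ge>Suc k. P i)"
  by (metis Suc_leD Suc_leI le_neq_implies_less order_refl)

lemma pos_iff_less:
  fixes f :: "nat \<Rightarrow> nat"
  shows "(\<forall>i. 0 < f i \<longleftrightarrow> i < u) \<longleftrightarrow> (\<forall>i<u. 0 < f i) \<and> (\<forall>i\<ge>u. f i = 0)"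
  by (metis gr0I less_irrefl not_le)

text \<open>In a steadily decreasing pair each entry of row k bounds both entries of every earlier
  row from below, so exact row numbers amount to positivity in row k.\<close>

lemma tight_exact_iff:
  assumes "steadily_decreasing f g"
  shows "tight_exact (Suc k) (Suc k) f g \<longleftrightarrow> tight_within (Suc k) (Suc k) f g \<and> 0 < f k \<and> 0 < g k"
    and "tight_exact (Suc k) k f g \<longleftrightarrow> tight_within (Suc k) k f g \<and> 0 < f k"
    and "tight_exact k (Suc k) f g \<longleftrightarrow> tight_within k (Suc k) f g \<and> 0 < g k"
proof -
  have dec: "f k \<le> f i \<and> g k \<le> g i" if "i \<le> k" for i
    using steadily_decreasing_imp_decseq[OF assms] that by (auto simp: decseq_def)
  have dec': "g k \<le> f i \<and> f k \<le> g i" if "i < k" for i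
  proof -
    have "max (f (Suc i)) (g (Suc i)) \<le> min (f i) (g i)"
      using assms by (simp add: steadily_decreasing_def)
    then show ?thesis using dec[of "Suc i"] that by simp
  qed
  have f: "(\<forall>i<Suc k. 0 < f i) \<longleftrightarrow> 0 < f k" and g: "(\<forall>i<Suc k. 0 < g i) \<longleftrightarrow> 0 < g k"
    using dec by (fastforce simp: less_Suc_eq_le)+
  have f': "0 < f k \<longrightarrow> (\<forall>i<k. 0 < g i)" and g': "0 < g k \<longrightarrow> (\<forall>i<k. 0 < f i)"
    using dec' by (fastforce)+
  show "tight_exact (Suc k) (Suc k) f g \<longleftrightarrow> tight_within (Suc k) (Suc k) f g \<and> 0 < f k \<and> 0 < g k"
    "tight_exact (Suc k) k f g \<longleftrightarrow> tight_within (Suc k) k f g \<and> 0 < f k"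
    "tight_exact k (Suc k) f g \<longleftrightarrow> tight_within k (Suc k) f g \<and> 0 < g k"
    unfolding tight_exact_def tight_within_def pos_iff_less f g using f' g' by argo+
qed

lemma tight_within_Suc_iff:
  "tight_within u v f g \<longleftrightarrow> tight_within (Suc u) v f g \<and> f u = 0"
  "tight_within u v f g \<longleftrightarrow> tight_within u (Suc v) f g \<and> g v = 0"
  unfolding tight_within_def all_ge_iff[of u "\<lambda>i. f i = 0"] all_ge_iff[of v "\<lambda>i. g i = 0"] by blast+

text \<open>The cases are distinguished by which of \<open>f k\<close> and \<open>g k\<close>
  vanish.\<close>

lemma pair_gf_tight_within_split:
  "pair_gf (tight_within (Suc k) k) = pair_gf (tight_exact (Suc k) k) + pair_gf (tight_within k k)"
  "pair_gf (tight_within k (Suc k)) = pair_gf (tight_exact k (Suc k)) + pair_gf (tight_within k k)"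
  "pair_gf (tight_within (Suc k) (Suc k)) = pair_gf (tight_exact (Suc k) (Suc k))
     + pair_gf (tight_exact (Suc k) k) + pair_gf (tight_within k (Suc k))"
proof -
  show "pair_gf (tight_within (Suc k) k) = pair_gf (tight_exact (Suc k) k) + pair_gf (tight_within k k)"
    by (rule pair_gf_disj)
      (auto simp: tight_exact_iff tight_within_Suc_iff(1)[of k k],
        simp add: tight_exact_def)
  show "pair_gf (tight_within k (Suc k)) = pair_gf (tight_exact k (Suc k)) + pair_gf (tight_within k k)"
    by (rule pair_gf_disj)
      (auto simp: tight_exact_iff tight_within_Suc_iff(2)[of k k],
        simp add: tight_exact_def)
  define R where "R f g \<longleftrightarrow> tight_exact (Suc k) (Suc k) f g \<or> tight_exact (Suc k) k f g" for f g
  have "pair_gf (tight_within (Suc k) (Suc k)) = pair_gf R + pair_gf (tight_within k (Suc k))"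
  proof (rule pair_gf_disj)
    fix f g
    show "R f g \<Longrightarrow> \<not> tight_within k (Suc k) f g"
      unfolding R_def tight_exact_def tight_within_def by (metis lessI less_irrefl order_refl)
    assume "steadily_decreasing f g"
    then show "tight_within (Suc k) (Suc k) f g \<longleftrightarrow> R f g \<or> tight_within k (Suc k) f g"
      by (auto simp: R_def tight_exact_iff tight_within_Suc_iff(1)[of k "Suc k"] tight_within_Suc_iff(2)[of "Suc k" k])
  qed
  moreover have "pair_gf R = pair_gf (tight_exact (Suc k) (Suc k)) + pair_gf (tight_exact (Suc k) k)"
  proof (rule pair_gf_disj)
    fix f g
    show "tight_exact (Suc k) (Suc k) f g \<Longrightarrow> \<not> tight_exact (Suc k) k f g"
      unfolding tight_exact_def by (metis lessI less_irrefl)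
  qed (simp add: R_def)
  ultimately show "pair_gf (tight_within (Suc k) (Suc k)) = pair_gf (tight_exact (Suc k) (Suc k))
     + pair_gf (tight_exact (Suc k) k) + pair_gf (tight_within k (Suc k))"
    by simp
qed

lemma zeta_pow_0: "zeta_pow 0 = 1"
  by (simp add: zeta_pow_def)

lemma zeta_pow_add: "zeta_pow a * zeta_pow b = zeta_pow (a + b)"
  by (simp add: zeta_pow_def mult_single)

text \<open>From \<open>B (1 - y) = y E\<close> and \<open>C (1 - z) = z E\<close> follows
  \<open>(B + C + E) (1 - y) (1 - z) = E (1 - y z)\<close>, and \<zeta> cancels in
  \<open>y z\<close>. The bound on \<open>k\<close> stems from \<open>pair_gf_tight_exact\<close>;
  the first series is found directly.\<close>

lemma pair_gf_tight_within_Suc: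
  assumes "k \<ge> 1"
  shows "pair_gf (tight_within (Suc k) (Suc k)) *
      ((1 - fps_X ^ Suc k) * ((1 - z_mono 1 k) * (1 - z_mono (- 1) (Suc k)))) =
    pair_gf (tight_within k k) * (1 - fps_X ^ (k + Suc k))"
proof -
  define x :: "int_laurent_poly fps" where "x = fps_X ^ Suc k"
  define y where "y = z_mono 1 k"
  define z where "z = z_mono (- 1) (Suc k)"
  define A B C D E where "A = pair_gf (tight_exact (Suc k) (Suc k))"
    and "B = pair_gf (tight_exact (Suc k) k)" and "C = pair_gf (tight_exact k (Suc k))"
    and "D = pair_gf (tight_within (Suc k) (Suc k))" and "E = pair_gf (tight_within k k)"
  have A: "A = x * D"
    using pair_gf_tight_exact[of "Suc k" "Suc k"] assms by (simp add: A_def D_def x_def zeta_pow_0)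
  have B: "B * (1 - y) = y * E"
    using pair_gf_tight_exact[of "Suc k" k] pair_gf_tight_within_split(1)[of k] assms
    by (simp add: B_def E_def y_def algebra_simps)
  have C: "C * (1 - z) = z * E"
    using pair_gf_tight_exact[of k "Suc k"] pair_gf_tight_within_split(2)[of k] assms
    by (simp add: C_def E_def z_def algebra_simps)
  have D: "D * (1 - x) = B + C + E"
    using pair_gf_tight_within_split(2,3)[of k] A
    by (simp add: A_def[symmetric] B_def[symmetric] C_def[symmetric] D_def[symmetric] E_def[symmetric] algebra_simps)
  have yz: "y * z = fps_X ^ (k + Suc k)"
  proof -
    have "y * z = fps_const (zeta_pow 1 * zeta_pow (- 1)) * fps_X ^ (k + Suc k)"
      unfolding y_def z_def fps_const_mult[symmetric] power_add by (simp only: mult_ac)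
    then show ?thesis by (simp add: zeta_pow_add zeta_pow_0)
  qed
  have "D * ((1 - x) * ((1 - y) * (1 - z))) = (D * (1 - x)) * ((1 - y) * (1 - z))"
    by (simp only: mult.assoc)
  also have "\<dots> = (B * (1 - y)) * (1 - z) + (C * (1 - z)) * (1 - y) + E * ((1 - y) * (1 - z))"
    unfolding D distrib_right by (simp only: mult_ac)
  also have "\<dots> = E * (1 - y * z)"
    unfolding B C by (simp add: algebra_simps)
  finally show ?thesis
    unfolding yz by (simp only: x_def y_def z_def D_def E_def)
qed

lemma pair_gf_cong:
  assumes "\<And>f g. steadily_decreasing f g \<Longrightarrow> R f g \<longleftrightarrow> R' f g"
  shows "pair_gf R = pair_gf R'"
proof -
  have "count_pairs R m n = count_pairs R' m n" for m n
    by (rule count_pairs_cong) (rule assms)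
  then show ?thesis by (simp add: pair_gf_def)
qed

lemma pair_gf_tight_within_0: "pair_gf (tight_within 0 0) = 1"
proof (rule zcoeff_eqI, rule fps_ext)
  fix s n
  have "{(f, g). partition_of f M \<and> partition_of g N \<and> steadily_decreasing f g \<and> tight_within 0 0 f g} =
     (if M = 0 \<and> N = 0 then {(\<lambda>_. 0, \<lambda>_. 0)} else {})" for M N
    by (auto simp: tight_within_def tight_def fun_eq_iff partition_of_iff[of 0] decseq_def steadily_decreasing_def)
  then have "count_pairs (tight_within 0 0) m n = (if m = 0 \<and> n = 0 then 1 else 0)" for m n
    by (auto simp: count_pairs_def)
  then show "zcoeff s (pair_gf (tight_within 0 0)) $ n = zcoeff s 1 $ n"
    by (auto simp: zcoeff_pair_gf[OF tight_within_imp] zcoeff_1)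
qed

text \<open>Tightness with a single row forces \<open>f = 0\<close>, which leaves a geometric series
  for \<open>g 0\<close>.\<close>

lemma pair_gf_tight_within_1: "pair_gf (tight_within 1 1) * (1 - z_mono (- 1) 1) = 1"
proof -
  have "tight_within 1 1 f g \<longleftrightarrow> tight_within 0 1 f g" for f g
    using all_ge_iff[of 0 "\<lambda>i. f i = 0"] by (auto simp: tight_within_def tight_def)
  then have "pair_gf (tight_within 1 1) = pair_gf (tight_within 0 1)"
    by (intro pair_gf_cong)
  moreover have "pair_gf (tight_within 0 1) = z_mono (- 1) 1 * pair_gf (tight_within 0 1) + 1"
    using pair_gf_tight_within_split(2)[of 0] pair_gf_tight_exact[of 0 1]
    by (simp add: pair_gf_tight_within_0)
  ultimately show ?thesis by (simp add: algebra_simps)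
qed

text \<open>The recursion is iterated from \<open>D\<^sub>1\<close>. The product belonging to
  \<open>\<zeta> q\<close> is one factor shorter, since \<open>D\<^sub>1\<close> contributes none to
  it.\<close>

lemma pair_gf_tight_within_product:
  "pair_gf (tight_within (Suc k) (Suc k)) * (qpoch fps_X fps_X (Suc k) *
     (qpoch (fps_const (zeta_pow 1) * fps_X) fps_X k * qpoch (fps_const (zeta_pow (- 1)) * fps_X) fps_X (Suc k)))
   = qpoch fps_X (fps_X\<^sup>2) (Suc k)"
proof (induction k)
  case 0
  have "pair_gf (tight_within 1 1) * ((1 - fps_X) * (1 - z_mono (- 1) 1)) =
    (pair_gf (tight_within 1 1) * (1 - z_mono (- 1) 1)) * (1 - fps_X)"
    by (simp only: mult_ac)
  also have "\<dots> = 1 - fps_X"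
    unfolding pair_gf_tight_within_1 by simp
  finally show ?case by (simp add: qpoch_Suc)
next
  case (Suc k)
  define P where "P = qpoch fps_X fps_X (Suc k) * (qpoch (fps_const (zeta_pow 1) * fps_X) fps_X k *
    qpoch (fps_const (zeta_pow (- 1)) * fps_X) fps_X (Suc k))"
  have 1: "qpoch fps_X fps_X (Suc (Suc k)) = qpoch fps_X fps_X (Suc k) * (1 - (fps_X :: int_laurent_poly fps) ^ Suc (Suc k))"
    and 2: "qpoch (fps_const (zeta_pow 1) * fps_X) fps_X (Suc k) =
      qpoch (fps_const (zeta_pow 1) * fps_X) fps_X k * (1 - z_mono 1 (Suc k))"
    and 3: "qpoch (fps_const (zeta_pow (- 1)) * fps_X) fps_X (Suc (Suc k)) =
      qpoch (fps_const (zeta_pow (- 1)) * fps_X) fps_X (Suc k) * (1 - z_mono (- 1) (Suc (Suc k)))"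
    by (simp_all add: qpoch_Suc mult.assoc)
  have 4: "qpoch fps_X (fps_X\<^sup>2) (Suc (Suc k)) =
      qpoch fps_X (fps_X\<^sup>2) (Suc k) * (1 - (fps_X :: int_laurent_poly fps) ^ (Suc k + Suc (Suc k)))"
    by (simp add: qpoch_Suc power_mult[symmetric] mult_2 mult_2_right flip: power_Suc)
  have "pair_gf (tight_within (Suc (Suc k)) (Suc (Suc k))) * (qpoch fps_X fps_X (Suc (Suc k)) *
     (qpoch (fps_const (zeta_pow 1) * fps_X) fps_X (Suc k) *
      qpoch (fps_const (zeta_pow (- 1)) * fps_X) fps_X (Suc (Suc k)))) =
    (pair_gf (tight_within (Suc (Suc k)) (Suc (Suc k))) * ((1 - fps_X ^ Suc (Suc k)) *
       ((1 - z_mono 1 (Suc k)) * (1 - z_mono (- 1) (Suc (Suc k)))))) * P"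
    unfolding 1 2 3 P_def by (simp only: mult_ac)
  also have "\<dots> = (pair_gf (tight_within (Suc k) (Suc k)) * P) * (1 - fps_X ^ (Suc k + Suc (Suc k)))"
    by (subst pair_gf_tight_within_Suc) (simp, simp only: mult_ac)
  also have "\<dots> = qpoch fps_X (fps_X\<^sup>2) (Suc (Suc k))"
    unfolding P_def Suc.IH 4 ..
  finally show ?case .
qed

text \<open>For \<open>k \<ge> n\<close> the second partition has at most \<open>k\<close> rows, and
  \<open>f i \<le> g (i - 1)\<close> leaves at most \<open>k + 1\<close> for the first. This is
  uniform in the weight of \<open>f\<close>, so the whole Laurent polynomial in degree
  \<open>n\<close> agrees.\<close>

lemma tendsto_pair_gf_tight_within: "(\<lambda>k. pair_gf (tight_within (Suc k) (Suc k))) \<longlonglongrightarrow> pair_gf tight"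
proof (rule tendsto_fpsI)
  fix n
  show "\<forall>\<^sub>F k in sequentially. pair_gf (tight_within (Suc k) (Suc k)) $ n = pair_gf tight $ n"
    using eventually_ge_at_top[of n]
  proof eventually_elim
    case (elim k)
    have "count_pairs (tight_within (Suc k) (Suc k)) m (int n) = count_pairs tight m (int n)" for m
    proof (rule count_pairs_cong)
      fix f g assume fg: "steadily_decreasing f g" "partition_of g (nat (int n))"
      have g: "g i = 0" if "k \<le> i" for i
        using partition_of_vanishes[OF fg(2), of i] that elim by simp
      have f: "f i = 0" if i: "Suc k \<le> i" for i
      proof -
        have "max (f (Suc (i - 1))) (g (Suc (i - 1))) \<le> min (f (i - 1)) (g (i - 1))"
          using fg(1) unfolding steadily_decreasing_def by blast
        then show ?thesis using g[of "i - 1"] i by simp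
      qed
      show "tight_within (Suc k) (Suc k) f g \<longleftrightarrow> tight f g"
        using f g by (auto simp: tight_within_def)
    qed
    then show ?case by (simp add: pair_gf_def of_zcoeffs_def)
  qed
qed

text \<open>The limit of the product formula has numerator \<open>(q;q^2)\<close>; the factor
  \<open>(q^2;q^2)\<close> completes it to \<open>(q;q)\<close>, the numerator of the crank
  series.\<close>

lemma pair_gf_tight_mult:
  "qpoch_inf fps_X fps_X * (qpoch_inf (fps_X\<^sup>2) (fps_X\<^sup>2) * pair_gf tight) = crank_gf"
proof -
  define f where "f = qpoch_inf (fps_const (zeta_pow 1) * fps_X) fps_X *
    qpoch_inf (fps_const (zeta_pow (- 1)) * fps_X) fps_X"
  have "pair_gf tight * (qpoch_inf fps_X fps_X * f) = qpoch_inf fps_X (fps_X\<^sup>2)"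
  proof (rule LIMSEQ_unique)
    show "(\<lambda>k. pair_gf (tight_within (Suc k) (Suc k)) * (qpoch fps_X fps_X (Suc k) *
       (qpoch (fps_const (zeta_pow 1) * fps_X) fps_X k * qpoch (fps_const (zeta_pow (- 1)) * fps_X) fps_X (Suc k))))
      \<longlonglongrightarrow> pair_gf tight * (qpoch_inf fps_X fps_X * f)"
      unfolding f_def
      by (intro tendsto_fps_mult tendsto_pair_gf_tight_within tendsto_qpoch LIMSEQ_Suc[OF tendsto_qpoch]) simp_all
    show "(\<lambda>k. pair_gf (tight_within (Suc k) (Suc k)) * (qpoch fps_X fps_X (Suc k) *
       (qpoch (fps_const (zeta_pow 1) * fps_X) fps_X k * qpoch (fps_const (zeta_pow (- 1)) * fps_X) fps_X (Suc k))))
      \<longlonglongrightarrow> qpoch_inf fps_X (fps_X\<^sup>2)"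
      unfolding pair_gf_tight_within_product by (intro LIMSEQ_Suc[OF tendsto_qpoch]) simp_all
  qed
  moreover have "(qpoch_inf fps_X fps_X * (qpoch_inf (fps_X\<^sup>2) (fps_X\<^sup>2) * pair_gf tight)) * f =
      (pair_gf tight * (qpoch_inf fps_X fps_X * f)) * qpoch_inf (fps_X\<^sup>2) (fps_X\<^sup>2)"
    by (simp only: mult_ac)
  ultimately have "(qpoch_inf fps_X fps_X * (qpoch_inf (fps_X\<^sup>2) (fps_X\<^sup>2) * pair_gf tight)) * f =
      qpoch_inf fps_X fps_X"
    by (simp only: qpoch_inf_odd_even)
  then show ?thesis
    using eq_mult_of_mult_eq_1[OF _ recip_coeff_mult_qpoch_inf] unfolding f_def crank_gf_eq_recip_coeff by blast
qed

lemma zcoeff_pair_gf_tight: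
  "zcoeff s (pair_gf tight) = zcoeff s crank_gf * Abs_fps cubic_partitions"
proof (rule eq_mult_of_mult_eq_1)
  have "zcoeff s crank_gf = qpoch_inf fps_X fps_X * (qpoch_inf (fps_X\<^sup>2) (fps_X\<^sup>2) * zcoeff s (pair_gf tight))"
    unfolding pair_gf_tight_mult[symmetric]
    using zcoeff_qpoch_inf_mult[of 1 1 s] zcoeff_qpoch_inf_mult[of 2 2 s] by simp
  then show "zcoeff s (pair_gf tight) * (qpoch_inf fps_X fps_X * qpoch_inf (fps_X\<^sup>2) (fps_X\<^sup>2)) = zcoeff s crank_gf"
    by (simp only: mult_ac)
qed (rule cubic_partitions_gf)

subsection \<open>The two formulas\<close>

text \<open>The pairs that are not tight come from arbitrary pairs by inserting columns of lengths 1
  and 0.\<close>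

lemma D_diff_eq_count_pairs: "D_diff m n = int (count_pairs tight (int m) (int n))"
proof -
  have pairs: "count_pairs (\<lambda>_ _. True) (int m) (int n) = num_steady_pairs m n" for m
    by (simp add: count_pairs_def num_steady_pairs_def)
  have "count_pairs (\<lambda>f g. \<not> tight f g) (int m) (int n) =
      count_pairs (\<lambda>_ _. True) (int m - int 1) (int n - int 0)"
  proof (rule count_pairs_raise)
    fix f g assume fg: "steadily_decreasing f g" "\<not> tight f g"
    have sd: "max (f (Suc i)) (g (Suc i)) \<le> min (f i) (g i)" for i
      using fg(1) by (simp add: steadily_decreasing_def)
    have gt: "max (f 1) (g 1) < f 0"
      using sd[of 0] fg(2) by (auto simp: tight_def max_def split: if_splits)
    have "f = raise 1 (f(0 := f 0 - 1))"
      using gt by (auto simp: raise_def fun_eq_iff)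
    moreover have "g = raise 0 g"
      by (simp add: raise_def)
    moreover have "max ((f(0 := f 0 - 1)) (Suc i)) (g (Suc i)) \<le> min ((f(0 := f 0 - 1)) i) (g i)" for i
      using sd[of i] gt by auto
    then have "steadily_decreasing (f(0 := f 0 - 1)) g"
      unfolding steadily_decreasing_def by blast
    ultimately show "\<exists>f' g'. f = raise 1 f' \<and> g = raise 0 g' \<and> steadily_decreasing f' g' \<and> True"
      by blast
  next
    fix f g assume fg: "steadily_decreasing f g"
    have "max (f (Suc 0)) (g (Suc 0)) \<le> min (f 0) (g 0)"
      using fg by (simp add: steadily_decreasing_def)
    then have "\<not> tight (raise 1 f) (raise 0 g)"
      by (auto simp: tight_def raise_def max_def)
    then show "steadily_decreasing (raise 1 f) (raise 0 g) \<and> \<not> tight (raise 1 f) (raise 0 g)"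
      using steadily_decreasing_raise[OF fg, of 1 0] by simp
  qed
  moreover have "count_pairs (\<lambda>_ _. True) (int m) (int n) =
      count_pairs tight (int m) (int n) + count_pairs (\<lambda>f g. \<not> tight f g) (int m) (int n)"
    by (rule count_pairs_disj) auto
  ultimately have "int (num_steady_pairs m n) =
      int (count_pairs tight (int m) (int n)) + int (count_pairs (\<lambda>_ _. True) (int m - 1) (int n))"
    by (simp add: pairs)
  moreover have "count_pairs (\<lambda>_ _. True) (int m - 1) (int n) = (if m = 0 then 0 else num_steady_pairs (m - 1) n)"
  proof (cases m)
    case 0
    then show ?thesis by (simp add: count_pairs_def)
  next
    case (Suc k)
    then show ?thesis using pairs[of k] by simp
  qed
  ultimately show ?thesis by (simp add: D_diff_def)
qed

lemma D_diff_eq_nth: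
  "D_diff m n = (zcoeff (int m - int n) crank_gf * Abs_fps cubic_partitions) $ n"
  unfolding zcoeff_pair_gf_tight[symmetric]
  by (simp add: zcoeff_pair_gf D_diff_eq_count_pairs)

section \<open>Summation over the first argument\<close>

lemma num_steady_pairs_eq_sum_D_diff: "int (num_steady_pairs m n) = (\<Sum>j\<le>m. D_diff j n)"
  by (induction m) (simp_all add: D_diff_def)

lemma num_steady_pairs_commute: "num_steady_pairs m n = num_steady_pairs n m"
  unfolding num_steady_pairs_def
  by (rule bij_betw_same_card[of prod.swap], rule bij_betw_byWitness[of _ prod.swap])
    (auto simp: steadily_decreasing_def min.commute max.commute)

definition alpha_gf :: "nat \<Rightarrow> int fps" where
  "alpha_gf s = Abs_fps (alpha_coeff s)"

text \<open>The term l = 0 gives p(n). In the others, shifting l by one raises \<open>s\<close> by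
  one, splits off \<open>q^(s+1)\<close> and changes the sign.\<close>

lemma alpha_gf_rec: "alpha_gf s + fps_X ^ Suc s * alpha_gf (Suc s) = partition_gf"
proof (rule fps_ext)
  fix n
  define t where "t s n l = (-1) ^ l * int (num_partitions (int n - int (l * (l + 1) div 2) - int (l * s)))"
    for s n l :: nat
  have "alpha_gf s $ n = (\<Sum>l<Suc n. t s n l)"
    by (simp add: alpha_gf_def alpha_coeff_finite t_def lessThan_Suc_atMost)
  also have "\<dots> = t s n 0 + (\<Sum>l<n. t s n (Suc l))"
    by (rule sum.lessThan_Suc_shift)
  also have "t s n 0 = partition_gf $ n"
    by (simp add: t_def partition_gf_def)
  also have "(\<Sum>l<n. t s n (Suc l)) = - (fps_X ^ Suc s * alpha_gf (Suc s)) $ n"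
  proof -
    have tri: "Suc l * (Suc l + 1) div 2 + Suc l * s = l * (l + 1) div 2 + l * Suc s + Suc s" for l
    proof -
      have "Suc l * (Suc l + 1) = l * (l + 1) + (l + 1) * 2" by (simp add: algebra_simps)
      then have "Suc l * (Suc l + 1) div 2 = (l * (l + 1) + (l + 1) * 2) div 2" by (simp only:)
      also have "\<dots> = l + 1 + l * (l + 1) div 2" by (rule div_mult_self1) simp
      finally have "Suc l * (Suc l + 1) div 2 = l + 1 + l * (l + 1) div 2" .
      then show ?thesis by (simp add: algebra_simps)
    qed
    have e: "int n - int (Suc l * (Suc l + 1) div 2) - int (Suc l * s) =
        int n - int (Suc s) - int (l * (l + 1) div 2) - int (l * Suc s)" for l
      using arg_cong[OF tri[of l], of int] by (simp only: of_nat_add)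
    show ?thesis
    proof (cases "n < Suc s")
      case True
      have "t s n (Suc l) = 0" for l
      proof -
        have "int n - int (Suc s) - int (l * (l + 1) div 2) - int (l * Suc s) < 0"
          using True by linarith
        then show ?thesis unfolding t_def e num_partitions_def by (simp only: if_True)
      qed
      then show ?thesis using True by (simp add: fps_X_power_mult_nth del: power_Suc)
    next
      case False
      have "- (fps_X ^ Suc s * alpha_gf (Suc s)) $ n = (\<Sum>l\<le>n - Suc s. - t (Suc s) (n - Suc s) l)"
        using False by (simp add: fps_X_power_mult_nth alpha_gf_def alpha_coeff_finite t_def sum_negf del: power_Suc)
      \<comment> \<open>The added terms are zero, as p is taken at negative arguments there.\<close>
      also have "\<dots> = (\<Sum>l<n. - t (Suc s) (n - Suc s) l)"
      proof (rule sum.mono_neutral_left)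
        show "\<forall>l\<in>{..<n} - {..n - Suc s}. - t (Suc s) (n - Suc s) l = 0"
        proof
          fix l assume "l \<in> {..<n} - {..n - Suc s}"
          then have "n - Suc s < l * Suc s" by simp
          then have "int (n - Suc s) < int (l * Suc s)" by (simp only: of_nat_less_iff)
          then have "int (n - Suc s) - int (l * (l + 1) div 2) - int (l * Suc s) < 0" by linarith
          then show "- t (Suc s) (n - Suc s) l = 0" by (simp only: t_def num_partitions_def) simp
        qed
      qed (use False in auto)
      also have "\<dots> = (\<Sum>l<n. t s n (Suc l))"
      proof (rule sum.cong[OF refl])
        fix l
        have "int (n - Suc s) = int n - int (Suc s)" using False by simp
        then show "- t (Suc s) (n - Suc s) l = t s n (Suc l)"
          unfolding t_def e by simp
      qed
      finally show ?thesis by simp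
    qed
  qed
  finally show "(alpha_gf s + fps_X ^ Suc s * alpha_gf (Suc s)) $ n = partition_gf $ n"
    by simp
qed

lemma recip_coeff_rec:
  "recip_coeff 1 0 (int s) + fps_X ^ s * recip_coeff 1 0 (int (Suc s)) = fps_X ^ s * (partition_gf * partition_gf)"
proof (rule LIMSEQ_unique)
  show "(\<lambda>N. recip_coeff_sum 1 0 (int s) N + fps_X ^ s * recip_coeff_sum 1 0 (int (Suc s)) N)
      \<longlonglongrightarrow> recip_coeff 1 0 (int s) + fps_X ^ s * recip_coeff 1 0 (int (Suc s))"
    by (intro tendsto_fps_add tendsto_fps_mult tendsto_recip_coeff_sum tendsto_const) auto
  show "(\<lambda>N. recip_coeff_sum 1 0 (int s) N + fps_X ^ s * recip_coeff_sum 1 0 (int (Suc s)) N)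
      \<longlonglongrightarrow> fps_X ^ s * (partition_gf * partition_gf)"
    unfolding recip_coeff_sum_telescope
    by (intro tendsto_fps_mult tendsto_const tendsto_inv_qfac
      LIMSEQ_ignore_initial_segment[OF tendsto_inv_qfac])
qed

lemma qpoch_inf_mult_recip_coeff: "qpoch_inf fps_X fps_X * recip_coeff 1 0 (int s) = fps_X ^ s * alpha_gf s"
proof -
  define d where "d s = qpoch_inf fps_X fps_X * recip_coeff 1 0 (int s) - fps_X ^ s * alpha_gf s" for s
  have rec: "d s = - (fps_X ^ s * d (Suc s))" for s
  proof -
    have "qpoch_inf fps_X fps_X * (recip_coeff 1 0 (int s) + fps_X ^ s * recip_coeff 1 0 (int (Suc s))) =
        fps_X ^ s * ((qpoch_inf fps_X fps_X * partition_gf) * partition_gf)"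
      unfolding recip_coeff_rec by (simp only: mult_ac)
    also have "\<dots> = fps_X ^ s * (alpha_gf s + fps_X ^ Suc s * alpha_gf (Suc s))"
      unfolding alpha_gf_rec qpoch_inf_mult_partition_gf by simp
    finally show ?thesis unfolding d_def by (simp add: algebra_simps)
  qed
  \<comment> \<open>For \<open>s \<ge> 1\<close> the factor \<open>q^s\<close> strictly lowers the
    index, so induction on it applies. At \<open>s = 0\<close> there is no shift, and vanishing is
    inherited from \<open>d 1\<close>.\<close>
  have pos: "d s $ n = 0" if "s \<ge> 1" for s n
    using that
  proof (induction n arbitrary: s rule: less_induct)
    case (less n)
    have "d s $ n = - (if n < s then 0 else d (Suc s) $ (n - s))"
      by (subst rec) (simp add: fps_X_power_mult_nth)
    moreover have "d (Suc s) $ (n - s) = 0" if "\<not> n < s"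
      using less.IH[of "n - s" "Suc s"] less.prems that by simp
    ultimately show ?case by simp
  qed
  have "d s = 0"
  proof (cases s)
    case 0
    have "d 1 = 0" using pos[of 1] by (simp add: fps_eq_iff)
    then show ?thesis using rec[of 0] 0 by simp
  next
    case (Suc k)
    then show ?thesis using pos[of s] by (simp add: fps_eq_iff)
  qed
  then show ?thesis by (simp add: d_def)
qed

lemma sum_zcoeff_crank_gf:
  assumes "m \<le> n"
  shows "(\<Sum>j\<le>m. zcoeff (int j - int n) crank_gf) =
    fps_X ^ (n - m) * alpha_gf (n - m) - fps_X ^ Suc n * alpha_gf (Suc n)"
proof -
  \<comment> \<open>Reflection makes the index \<open>n - j\<close> nonnegative, as required by
    \<open>recip_coeff_right\<close> at \<open>j = 0\<close>.\<close>
  have tel: "recip_coeff 1 1 (int j - int n) = recip_coeff 1 0 (int n - int j) - recip_coeff 1 0 (int n - int j + 1)"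
    if "j \<le> m" for j
    using recip_coeff_right[of 0 1 "int n - int j"] recip_coeff_symmetric[of "int n - int j"] that assms by simp
  have "(\<Sum>j\<le>k. recip_coeff 1 1 (int j - int n)) = recip_coeff 1 0 (int n - int k) - recip_coeff 1 0 (int (Suc n))"
    if "k \<le> m" for k
    using that
  proof (induction k)
    case 0
    show ?case using tel[of 0] by (simp add: add_ac)
  next
    case (Suc k)
    then show ?case using tel[of "Suc k"] by simp
  qed
  from this[of m] have "(\<Sum>j\<le>m. recip_coeff 1 1 (int j - int n)) = recip_coeff 1 0 (int (n - m)) - recip_coeff 1 0 (int (Suc n))"
    using assms by (simp only: of_nat_diff)
  then show ?thesis
    unfolding zcoeff_crank_gf sum_distrib_left[symmetric] qpoch_inf_mult_recip_coeff[symmetric]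
    by (simp only: right_diff_distrib)
qed

lemma num_steady_pairs_formula:
  assumes "m \<le> n"
  shows "int (num_steady_pairs m n) = (\<Sum>k = 0..m. cubic_partitions (m - k) * alpha_coeff (n - m) k)"
proof -
  define C where "C = Abs_fps cubic_partitions"
  have "int (num_steady_pairs m n) = ((\<Sum>j\<le>m. zcoeff (int j - int n) crank_gf) * C) $ n"
    by (simp add: num_steady_pairs_eq_sum_D_diff D_diff_eq_nth C_def sum_distrib_right fps_sum_nth)
  also have "\<dots> = (fps_X ^ (n - m) * (alpha_gf (n - m) * C)) $ n - (fps_X ^ Suc n * (alpha_gf (Suc n) * C)) $ n"
    unfolding sum_zcoeff_crank_gf[OF assms] by (simp add: left_diff_distrib mult.assoc)
  \<comment> \<open>The second term starts in degree \<open>n + 1\<close> and drops out; the first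
    moves index \<open>n\<close> to \<open>m\<close>.\<close>
  also have "\<dots> = (alpha_gf (n - m) * C) $ m"
    unfolding fps_X_power_mult_nth using assms by simp
  also have "\<dots> = (\<Sum>k = 0..m. cubic_partitions (m - k) * alpha_coeff (n - m) k)"
    unfolding fps_mult_nth by (simp add: alpha_gf_def C_def mult.commute)
  finally show ?thesis .
qed

lemma num_partitions_0: "num_partitions 0 = 1"
proof -
  have "{f. partition_of f 0} = {\<lambda>_. 0}" by (auto simp: partition_of_0_iff)
  then show ?thesis by (simp add: num_partitions_def)
qed

lemma cubic_partitions_0: "cubic_partitions 0 = 1"
  by (simp add: cubic_partitions_def)

lemma num_steady_pairs_0: "num_steady_pairs 0 k = 1"
  using num_steady_pairs_formula[of 0 k]
  by (simp add: cubic_partitions_0 alpha_coeff_finite num_partitions_0)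

text \<open>With \<open>a\<close> the distance of \<open>m\<close> and \<open>n\<close>,
  \<open>L_index m n\<close> equals \<open>n - a\<close>. The crank coefficients of
  \<open>\<zeta>^a\<close> vanish below degree \<open>a\<close>, so the convolution is reindexed by
  \<open>i = a + k\<close>; crank symmetry covers \<open>m < n\<close>.\<close>

lemma D_diff_formula:
  "D_diff m n = (\<Sum>k \<in> {0..L_index m n}. cubic_partitions (nat (L_index m n - k)) *
     crank_count (int n - L_index m n) (nat (int n - L_index m n + k)))"
proof -
  define a where "a = nat \<bar>int m - int n\<bar>"
  have L: "L_index m n = int n - int a" by (simp add: L_index_def a_def)
  have M: "crank_count (int m - int n) i = crank_count (int a) i" for i
  proof (cases "m \<le> n")
    case True
    then show ?thesis using crank_count_minus[of "int n - int m" i] by (simp add: a_def)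
  qed (simp add: a_def)
  have "D_diff m n = (\<Sum>i = 0..n. crank_count (int a) i * cubic_partitions (n - i))"
    by (simp add: D_diff_eq_nth fps_mult_nth crank_count_eq[symmetric] M)
  also have "\<dots> = (\<Sum>i \<in> {a..n}. crank_count (int a) i * cubic_partitions (n - i))"
    by (rule sum.mono_neutral_right) (auto simp: crank_count_eq_0)
  also have "\<dots> = (\<Sum>k \<in> {0..L_index m n}. cubic_partitions (nat (L_index m n - k)) *
     crank_count (int n - L_index m n) (nat (int n - L_index m n + k)))"
    by (rule sum.reindex_bij_witness[of _ "\<lambda>k. nat (int a + k)" "\<lambda>i. int i - int a"])
      (auto simp: L nat_diff_distrib mult.commute)
  finally show ?thesis .
qed

theorem proposition1p1:
  fixes m n :: nat
  shows
    "int (num_steady_pairs m n) =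
       (\<Sum>k = 0..min m n.
          cubic_partitions (min m n - k) * alpha_coeff (nat \<bar>int m - int n\<bar>) k)
     \<and> (\<forall>k. num_steady_pairs 0 k = 1 \<and> num_steady_pairs k 0 = 1)
     \<and> D_diff m n =
       (\<Sum>k \<in> {0..L_index m n}.
          cubic_partitions (nat (L_index m n - k)) *
          crank_count (int n - L_index m n) (nat (int n - L_index m n + k)))
     \<and> (m > 2 * n \<longrightarrow> D_diff m n = 0)"
proof (intro conjI allI impI)
  show "int (num_steady_pairs m n) =
       (\<Sum>k = 0..min m n. cubic_partitions (min m n - k) * alpha_coeff (nat \<bar>int m - int n\<bar>) k)"
  proof (cases "m \<le> n")
    case True
    then have "nat \<bar>int m - int n\<bar> = n - m" by simp
    then show ?thesis using num_steady_pairs_formula[OF True] True by (simp add: min_absorb1)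
  next
    case False
    then have "nat \<bar>int m - int n\<bar> = m - n" by simp
    then show ?thesis using num_steady_pairs_formula[of n m] False
      by (simp add: min_absorb2 num_steady_pairs_commute[of m n])
  qed
  show "num_steady_pairs 0 k = 1" "num_steady_pairs k 0 = 1" for k
    by (simp_all add: num_steady_pairs_0 num_steady_pairs_commute[of k 0])
  show "D_diff m n = (\<Sum>k \<in> {0..L_index m n}. cubic_partitions (nat (L_index m n - k)) *
     crank_count (int n - L_index m n) (nat (int n - L_index m n + k)))"
    by (rule D_diff_formula)
  show "D_diff m n = 0" if "m > 2 * n"
    \<comment> \<open>Here \<open>L_index m n\<close> is negative and the sum is empty.\<close>
    unfolding D_diff_formula using that by (simp add: L_index_def)
qed

end
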